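(* Let $d\ge 1$ and let $L$ be a $d$-dimensional integration lattice such that the lattice point set $\mathcal{P}(L)=L\cap[0,1)^d$ has exactly $N$ elements. Then $$\frac{1}{\sqrt d}\,\sigma(L)\ \le\ J_N(\mathcal P(L))\ \le\ d^2\,2^d\,\sigma(L).$$ Moreover, there exists an absolute constant $c>0$ (independent of $d$, $L$ and $N$) such that for every $d\ge1$ and every such $L$ which additionally satisfies $\sigma(L)\le1/2$, we have $c\,\sigma(L)\le J_N(\mathcal P(L))$.
   Context: A $d$-dimensional lattice is a set $L=\{\sum_{i=1}^d k_i\boldsymbol b_i: k_i\in\mathbb Z\}$ where $\boldsymbol b_1,\dots,\boldsymbol b_d$ is a basis of $\mathbb R^d$. An integration lattice is a lattice with $\mathbb Z^d\subseteq L$. For an integration lattice $L$, the lattice point set is $\mathcal P(L)=L\cap[0,1)^d$ (a finite set). The dual lattice is $L^\perp=\{\boldsymbol h\in\mathbb R^d: \boldsymbol h\cdot\boldsymbol g\in\mathbb Z \text{ for all }\boldsymbol g\in L\}$, and the spectral test is $\sigma(L)=1/\min\{\|\boldsymbol h\|_2:\boldsymbol h\in L^\perp\setminus\{\boldsymbol 0\}\}$. For a finite point set $\mathcal P=\{\boldsymbol x_0,\dots,\boldsymbol x_{N-1}\}\subset[0,1)^d$ the isotropic discrepancy is $J_N(\mathcal P)=\sup_C\left|\frac{\#\{n:0\le n<N,\ \boldsymbol x_n\in C\}}{N}-\mathrm{volume}(C)\right|$, the supremum over all convex subsets $C\subseteq[0,1)^d$. *)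

theory Defs
  imports "HOL-Analysis.Analysis"
begin

(* The constant in the second half of the theorem does not depend on the dimension, so the
   dimension has to be a quantifiable natural number and not a type.  A point of d-dimensional
   space is therefore an extensional function on {..<d}, which makes the ambient space equal to
   the underlying set of the product measure space used for the volume below.  All
   vector-valued expressions are restricted to {..<d} to stay inside it. *)

definition eucl_space :: "nat \<Rightarrow> (nat \<Rightarrow> real) set" where
  "eucl_space d = {..<d} \<rightarrow>\<^sub>E UNIV"

definition zero_vector :: "nat \<Rightarrow> nat \<Rightarrow> real" where
  "zero_vector d = (\<lambda>i\<in>{..<d}. 0)"

definition dot :: "nat \<Rightarrow> (nat \<Rightarrow> real) \<Rightarrow> (nat \<Rightarrow> real) \<Rightarrow> real" where
  "dot d x y = (\<Sum>i<d. x i * y i)"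

definition lin_comb :: "nat \<Rightarrow> (nat \<Rightarrow> real) \<Rightarrow> (nat \<Rightarrow> nat \<Rightarrow> real) \<Rightarrow> nat \<Rightarrow> real" where
  "lin_comb d a b = (\<lambda>i\<in>{..<d}. \<Sum>j<d. a j * b j i)"

definition is_basis :: "nat \<Rightarrow> (nat \<Rightarrow> nat \<Rightarrow> real) \<Rightarrow> bool" where
  "is_basis d b \<longleftrightarrow>
     (\<forall>j<d. b j \<in> eucl_space d) \<and>
     (\<forall>a. lin_comb d a b = zero_vector d \<longrightarrow> (\<forall>j<d. a j = 0)) \<and>
     (\<forall>x\<in>eucl_space d. \<exists>a. x = lin_comb d a b)"

definition is_lattice :: "nat \<Rightarrow> (nat \<Rightarrow> real) set \<Rightarrow> bool" where
  "is_lattice d L \<longleftrightarrow>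
     (\<exists>b. is_basis d b \<and> L = {lin_comb d (\<lambda>j. of_int (k j)) b |k :: nat \<Rightarrow> int. True})"

definition integration_lattice :: "nat \<Rightarrow> (nat \<Rightarrow> real) set \<Rightarrow> bool" where
  "integration_lattice d L \<longleftrightarrow> is_lattice d L \<and> ({..<d} \<rightarrow>\<^sub>E \<int>) \<subseteq> L"

definition unit_cube :: "nat \<Rightarrow> (nat \<Rightarrow> real) set" where
  "unit_cube d = {..<d} \<rightarrow>\<^sub>E {0..<1}"

definition lattice_points :: "nat \<Rightarrow> (nat \<Rightarrow> real) set \<Rightarrow> (nat \<Rightarrow> real) set" where
  "lattice_points d L = L \<inter> unit_cube d"

definition dual_lattice :: "nat \<Rightarrow> (nat \<Rightarrow> real) set \<Rightarrow> (nat \<Rightarrow> real) set" where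
  "dual_lattice d L = {h \<in> eucl_space d. \<forall>g\<in>L. dot d h g \<in> \<int>}"

(* The set of lengths is infinite, so Min does not apply; LEAST is its minimum. *)
definition spectral_test :: "nat \<Rightarrow> (nat \<Rightarrow> real) set \<Rightarrow> real" where
  "spectral_test d L =
     1 / (LEAST r. \<exists>h \<in> dual_lattice d L - {zero_vector d}. r = L2_set h {..<d})"

definition convex_set :: "nat \<Rightarrow> (nat \<Rightarrow> real) set \<Rightarrow> bool" where
  "convex_set d C \<longleftrightarrow>
     (\<forall>x\<in>C. \<forall>y\<in>C. \<forall>u\<ge>0. \<forall>v\<ge>0. u + v = 1 \<longrightarrow> (\<lambda>i\<in>{..<d}. u * x i + v * y i) \<in> C)"

(* The completion is needed: convex sets are Lebesgue measurable but not always Borel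
   measurable, and measure is 0 on non-measurable sets. *)
definition volume :: "nat \<Rightarrow> (nat \<Rightarrow> real) set \<Rightarrow> real" where
  "volume d C = measure (completion (\<Pi>\<^sub>M i\<in>{..<d}. lborel)) C"

(* N is the number of points of the point set P, whose points are pairwise distinct. *)
definition isotropic_discrepancy :: "nat \<Rightarrow> nat \<Rightarrow> (nat \<Rightarrow> real) set \<Rightarrow> real" where
  "isotropic_discrepancy d N P =
     (SUP C \<in> {C. C \<subseteq> unit_cube d \<and> convex_set d C}.
        \<bar>real (card (P \<inter> C)) / real N - volume d C\<bar>)"

end

theory Submission
  imports Defs
begin

text \<open>
  Lower bounds: for a shortest nonzero dual vector \<open>h\<close>, an integer vector of length
  \<open>1 / \<sigma>(L)\<close>, the open slabs \<open>k < h \<cdot> x < k + 1\<close> contain no lattice points. At most \<open>\<parallel>h\<parallel>\<^sub>1\<close> of them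
  cover the cube up to a null set, so one has volume at least \<open>1 / \<parallel>h\<parallel>\<^sub>1 \<ge> \<sigma>(L) / \<surd>d\<close>. By Chebyshev's
  inequality \<open>4 \<parallel>h\<parallel>\<^sub>2\<close> slabs around the mean of \<open>h \<cdot> x\<close> already carry the volume \<open>3/4\<close>, which gives
  an absolute constant.

  Upper bound: projecting the dual lattice successively along nearly shortest vectors shows that the
  covering radius of \<open>L\<close> is at most \<open>2\<^sup>d \<sigma>(L) / 4\<close>. For \<open>D\<close> above this radius, both the volume of a
  convex set \<open>C\<close> and the proportion of lattice points in \<open>C\<close> lie between the volumes of
  the neighbourhood \<open>W = C + (-D, D)\<^sup>d\<close> and of the set of all \<open>x\<close> with \<open>x + [-2D, 2D]\<^sup>d \<subseteq> W\<close>. These two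
  differ by at most \<open>4 d D (1 + 2 D)\<^sup>d\<^sup>-\<^sup>1\<close>, since eroding a convex set in one coordinate direction
  shortens each fibre, an interval, by at most twice the radius.
\<close>

section \<open>Vectors, orthonormal families and a transference bound\<close>

text \<open>The factor 2^d is the price of the projections. A vector is used whose squared length is
  below twice the infimum, and projecting along it keeps at least half of the squared minimum
  \<open>l\<close>. The squared corrections therefore add up to (1 + 2 + ... + 2^(d-1)) / (4 l) =
  (2^d - 1) / (4 l), where 1 / l is the squared spectral test, and 2^d - 1 is at most 4^d / 4. The
  factor d^2 comes from 4 d D (1 + 2 D)^(d-1). If the claimed bound is at least 1, nothing is to be
  shown, since no local discrepancy exceeds 1. Otherwise the covering radius is so small that the
  power is at most d there. The obstacle is that a convex set is given with no topological or
  measurability information. Its open neighbourhoods are Borel whatever the set is, and eroding them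
  leads back into the set, so all measure estimates are made on these Borel sets. Openness forces
  \<open>D\<close> to exceed the covering radius; the value at the radius is reached by a
  limit.\<close>

lemma dot_commute: "dot d x y = dot d y x"
  by (simp add: dot_def mult.commute)

lemma dot_lincomb_left: "dot d (\<lambda>i. a * x i + b * y i) z = a * dot d x z + b * dot d y z"
  by (simp add: dot_def sum.distrib sum_distrib_left algebra_simps)

lemma dot_lincomb_right: "dot d z (\<lambda>i. a * x i + b * y i) = a * dot d z x + b * dot d z y"
  by (simp add: dot_def sum.distrib sum_distrib_left algebra_simps)

lemma dot_diff_left: "dot d (\<lambda>i. x i - y i) z = dot d x z - dot d y z"
  using dot_lincomb_left[of d 1 x "-1" y z] by simp

lemma dot_diff_right: "dot d z (\<lambda>i. x i - y i) = dot d z x - dot d z y"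
  using dot_lincomb_right[of d z 1 x "-1" y] by simp

lemma dot_add_left: "dot d (\<lambda>i. x i + y i) z = dot d x z + dot d y z"
  using dot_lincomb_left[of d 1 x 1 y z] by simp

lemma dot_scale_left: "dot d (\<lambda>i. a * x i) z = a * dot d x z"
  using dot_lincomb_left[of d a x 0 x z] by simp

lemma dot_scale_right: "dot d z (\<lambda>i. a * x i) = a * dot d z x"
  using dot_lincomb_right[of d z a x 0 x] by simp

lemma dot_divide_left: "dot d (\<lambda>i. x i / a) z = dot d x z / a"
  using dot_scale_left[of d "1 / a" x z] by simp

lemma dot_divide_right: "dot d z (\<lambda>i. x i / a) = dot d z x / a"
  using dot_scale_right[of d z "1 / a" x] by simp

lemma dot_self_add_orthogonal:
  assumes "dot d x y = 0"
  shows "dot d (\<lambda>i. x i + a * y i) (\<lambda>i. x i + a * y i) = dot d x x + a\<^sup>2 * dot d y y"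
proof -
  let ?z = "\<lambda>i. x i + a * y i"
  have 1: "dot d ?z ?z = dot d x ?z + a * dot d y ?z"
    by (simp only: dot_add_left dot_scale_left)
  have 2: "dot d x ?z = dot d x x" "dot d y ?z = a * dot d y y"
    using assms
    by (simp_all only: dot_commute[of d x ?z] dot_commute[of d y ?z] dot_add_left dot_scale_left
          dot_commute[of d y x])
  show ?thesis unfolding 1 2 by (simp add: power2_eq_square)
qed

lemma dot_self_nonneg: "0 \<le> dot d x x"
  by (simp add: dot_def sum_nonneg)

lemma dot_self_eq_0_iff: "dot d x x = 0 \<longleftrightarrow> (\<forall>i<d. x i = 0)"
  by (auto simp: dot_def sum_nonneg_eq_0_iff)

lemma dot_eq_0_if_null: "dot d x x = 0 \<Longrightarrow> dot d x y = 0"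
  by (simp add: dot_self_eq_0_iff) (simp add: dot_def)

text \<open>Bessel's inequality for each standard unit vector, summed over the \<open>d\<close> unit
  vectors: the left-hand sides add up to \<open>k\<close>, the right-hand sides to
  \<open>d\<close>.\<close>

lemma orthonormal_card_le:
  assumes "\<And>i j. i < k \<Longrightarrow> j < k \<Longrightarrow> dot d (w i) (w j) = (if i = j then 1 else 0)"
  shows "k \<le> d"
proof -
  have bessel: "(\<Sum>i<k. (w i j)\<^sup>2) \<le> 1" if "j < d" for j
  proof -
    \<comment> \<open>\<open>v\<close> is the orthogonal projection of the \<open>j\<close>-th unit
      vector onto the span of the \<open>w i\<close>. Its squared length equals its own
      \<open>j\<close>-th entry, and expanding the squared distance to the unit vector gives the
      inequality.\<close>
    define v where "v l = (\<Sum>i<k. w i j * w i l)" for l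
    have "(\<Sum>l<d. (v l)\<^sup>2) = (\<Sum>l<d. \<Sum>i<k. \<Sum>i'<k. w i j * w i' j * (w i l * w i' l))"
      by (simp add: v_def power2_eq_square sum_product mult_ac)
    also have "\<dots> = (\<Sum>i<k. \<Sum>i'<k. \<Sum>l<d. w i j * w i' j * (w i l * w i' l))"
      by (subst sum.swap) (intro sum.cong refl sum.swap)
    also have "\<dots> = (\<Sum>i<k. \<Sum>i'<k. w i j * w i' j * dot d (w i) (w i'))"
      by (simp add: dot_def sum_distrib_left)
    also have "\<dots> = (\<Sum>i<k. \<Sum>i'<k. if i = i' then w i j * w i' j else 0)"
      by (intro sum.cong refl) (simp add: assms)
    also have "\<dots> = v j"
      by (simp add: v_def)
    finally have sq: "(\<Sum>l<d. (v l)\<^sup>2) = v j" .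
    have vj: "v j = (\<Sum>i<k. (w i j)\<^sup>2)" by (simp add: v_def power2_eq_square)
    have "0 \<le> (\<Sum>l<d. ((if l = j then 1 else 0) - v l)\<^sup>2)"
      by (simp add: sum_nonneg)
    also have "\<dots> = (\<Sum>l<d. (if l = j then 1 - 2 * v j else 0) + (v l)\<^sup>2)"
      by (intro sum.cong refl) (simp add: power2_eq_square algebra_simps)
    also have "\<dots> = 1 - 2 * v j + (\<Sum>l<d. (v l)\<^sup>2)"
      using that by (simp add: sum.distrib)
    also have "\<dots> = 1 - (\<Sum>i<k. (w i j)\<^sup>2)"
      unfolding sq vj by simp
    finally show ?thesis by simp
  qed
  have "real k = (\<Sum>i<k. dot d (w i) (w i))"
    by (simp add: assms)
  also have "\<dots> = (\<Sum>j<d. \<Sum>i<k. (w i j)\<^sup>2)"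
    unfolding dot_def power2_eq_square by (rule sum.swap)
  also have "\<dots> \<le> (\<Sum>j<d. 1)"
    by (intro sum_mono) (use bessel in auto)
  finally show ?thesis by simp
qed

text \<open>A non-null \<open>u\<close> could be normalised and adjoined, giving
  \<open>d + 1\<close> orthonormal vectors.\<close>

lemma orthonormal_complete:
  assumes ortho: "\<And>i j. i < d \<Longrightarrow> j < d \<Longrightarrow> dot d (w i) (w j) = (if i = j then 1 else 0)"
    and u: "\<And>i. i < d \<Longrightarrow> dot d u (w i) = 0"
  shows "dot d u u = 0"
proof (rule ccontr)
  assume "dot d u u \<noteq> 0"
  with dot_self_nonneg[of d u] have pos: "dot d u u > 0" by linarith
  define w' where "w' = w(d := (\<lambda>i. u i / sqrt (dot d u u)))"
  have "dot d (w' i) (w' j) = (if i = j then 1 else 0)" if "i < Suc d" "j < Suc d" for i j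
    using that ortho u dot_commute[of d "w i" u] pos
    by (auto simp: w'_def dot_divide_left dot_divide_right less_Suc_eq)
  from orthonormal_card_le[of "Suc d" d w', OF this] show False by simp
qed

text \<open>
  A transference bound: \<open>M\<close> plays the role of the dual lattice and \<open>\<phi>\<close> that of the functional given by
  a point, which one wants to move to a point of the lattice by a short vector \<open>s\<close>. Passing to
  functionals that are only additive modulo 1 makes the statement stable under projecting \<open>M\<close> along a
  nearly shortest vector, so that no basis of \<open>M\<close> is needed. The family \<open>w\<close> only bounds the
  number of such projections.
\<close>
lemma integral_functional_correction:
  fixes l :: real
  assumes "k + m = d"
    and "\<And>i j. i < k \<Longrightarrow> j < k \<Longrightarrow> dot d (w i) (w j) = (if i = j then 1 else 0)"
    and "\<And>u v. u \<in> M \<Longrightarrow> v \<in> M \<Longrightarrow> (\<lambda>i. u i - v i) \<in> M"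
    and "\<And>u i. u \<in> M \<Longrightarrow> i < k \<Longrightarrow> dot d u (w i) = 0"
    and "0 < l"
    and "\<And>u. u \<in> M \<Longrightarrow> dot d u u \<noteq> 0 \<Longrightarrow> l \<le> dot d u u"
    and "\<And>u v. u \<in> M \<Longrightarrow> v \<in> M \<Longrightarrow> \<phi> (\<lambda>i. u i - v i) - (\<phi> u - \<phi> v) \<in> \<int>"
    and "\<And>u. u \<in> M \<Longrightarrow> dot d u u = 0 \<Longrightarrow> \<phi> u \<in> \<int>"
  shows "\<exists>s. (\<forall>i<k. dot d s (w i) = 0) \<and> (\<forall>u\<in>M. \<phi> u + dot d s u \<in> \<int>)
             \<and> dot d s s \<le> (2 ^ m - 1) / (4 * l)"
  using assms
proof (induction m arbitrary: k w M l \<phi>)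
  case 0
  \<comment> \<open>For \<open>m = 0\<close> the \<open>w i\<close> form a complete orthonormal
    family, so all vectors of \<open>M\<close> are null and no correction is required.\<close>
  have "dot d u u = 0" if "u \<in> M" for u
    using 0 that by (intro orthonormal_complete[of d w]) auto
  with 0 show ?case by (intro exI[of _ "\<lambda>_. 0"]) (auto simp: dot_def)
next
  case (Suc m)
  note ortho = Suc.prems(2) and diff = Suc.prems(3) and orthM = Suc.prems(4) and l = Suc.prems(5)
    and min = Suc.prems(6) and \<phi>diff = Suc.prems(7) and \<phi>null = Suc.prems(8)
  show ?case
  proof (cases "\<exists>u\<in>M. dot d u u \<noteq> 0")
    case False
    have "0 \<le> (2 ^ Suc m - 1) / (4 * l)"
      using l one_le_power[of "2::real" "Suc m"] by (intro divide_nonneg_pos) auto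
    with False \<phi>null show ?thesis
      by (intro exI[of _ "\<lambda>_. 0"]) (auto simp: dot_def)
  next
    case True
    define S where "S = {dot d u u |u. u \<in> M \<and> dot d u u \<noteq> 0}"
    define I where "I = Inf S"
    have Sne: "S \<noteq> {}" using True by (auto simp: S_def)
    have "l \<le> I" unfolding I_def using Sne min by (intro cInf_greatest) (auto simp: S_def)
    hence "I < 2 * I" using l by simp
    have bdd: "bdd_below S" by (rule bdd_belowI[of _ l]) (use min in \<open>auto simp: S_def\<close>)
    have I_le: "I \<le> dot d u u" if "u \<in> M" "dot d u u \<noteq> 0" for u
      unfolding I_def using that bdd by (intro cInf_lower) (auto simp: S_def)
    \<comment> \<open>A vector below \<open>2 * I\<close> avoids proving that the infimum is
      attained. The factor 2 is affordable because rounding leaves at most a quarter of the squared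
      length of \<open>h\<close>, which is then below \<open>I / 2\<close>.\<close>
    obtain h where h: "h \<in> M" "dot d h h \<noteq> 0" "dot d h h < 2 * I"
      using cInf_lessD[of S "2 * I"] Sne \<open>I < 2 * I\<close> unfolding I_def[symmetric] by (auto simp: S_def)
    define n where "n = dot d h h"
    have n: "n > 0" "I \<le> n" "n < 2 * I" using h I_le[OF h(1,2)] l \<open>l \<le> I\<close> by (auto simp: n_def)
    define P where "P u = (\<lambda>i. u i - dot d u h / n * h i)" for u :: "nat \<Rightarrow> real"
    have Ph: "dot d (P u) h = 0" for u
      using n unfolding P_def dot_diff_left dot_scale_left by (simp add: n_def)
    have Pdiff: "P (\<lambda>i. u i - v i) = (\<lambda>i. P u i - P v i)" for u v
      by (auto simp: P_def dot_diff_left diff_divide_distrib algebra_simps)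
    have zero: "(\<lambda>i. 0) \<in> M" using diff[OF h(1) h(1)] by simp
    have neg: "(\<lambda>i. - u i) \<in> M" if "u \<in> M" for u using diff[OF zero that] by simp
    have addM: "(\<lambda>i. u i + v i) \<in> M" if "u \<in> M" "v \<in> M" for u v
      using diff[OF that(1) neg[OF that(2)]] by simp
    \<comment> \<open>\<open>\<phi>\<close> is additive only modulo 1, so multiples of
      \<open>h\<close> are subtracted one at a time and the integer defects collected.\<close>
    have step: "(\<lambda>i. u i - of_int c * h i) \<in> M \<and>
        \<phi> (\<lambda>i. u i - of_int c * h i) - (\<phi> u - of_int c * \<phi> h) \<in> \<int>" if u: "u \<in> M" for u c
    proof (induction c rule: int_induct[where k = 0])
      case base
      then show ?case using u by simp
    next
      case (step1 c)
      have eq: "(\<lambda>i. (u i - of_int c * h i) - h i) = (\<lambda>i. u i - of_int (c + 1) * h i)"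
        by (auto simp: algebra_simps)
      have "\<phi> (\<lambda>i. (u i - of_int c * h i) - h i) - (\<phi> (\<lambda>i. u i - of_int c * h i) - \<phi> h) \<in> \<int>"
        using step1 h by (intro \<phi>diff) auto
      from Ints_add[OF this conjunct2[OF step1(2)]] diff[OF conjunct1[OF step1(2)] h(1)] show ?case
        unfolding eq by (simp add: algebra_simps)
    next
      case (step2 c)
      have eq: "(\<lambda>i. (u i - of_int (c - 1) * h i) - h i) = (\<lambda>i. u i - of_int c * h i)"
        and eq': "(\<lambda>i. (u i - of_int c * h i) + h i) = (\<lambda>i. u i - of_int (c - 1) * h i)"
        by (auto simp: algebra_simps)
      have mem: "(\<lambda>i. u i - of_int (c - 1) * h i) \<in> M"
        using addM[OF conjunct1[OF step2(2)] h(1)] by (simp add: eq')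
      have "\<phi> (\<lambda>i. u i - of_int c * h i) - (\<phi> (\<lambda>i. u i - of_int (c - 1) * h i) - \<phi> h) \<in> \<int>"
        using \<phi>diff[OF mem h(1)] by (simp only: eq)
      from Ints_diff[OF conjunct2[OF step2(2)] this] mem show ?case
        by (simp add: algebra_simps)
    qed
    have norm_step: "dot d (\<lambda>i. u i - of_int c * h i) (\<lambda>i. u i - of_int c * h i)
        = dot d (P u) (P u) + (dot d u h / n - of_int c)\<^sup>2 * n" for u and c :: int
    proof -
      have "(\<lambda>i. u i - of_int c * h i) = (\<lambda>i. P u i + (dot d u h / n - of_int c) * h i)"
        by (auto simp: P_def algebra_simps)
      then show ?thesis
        using dot_self_add_orthogonal[OF Ph[of u], of "dot d u h / n - of_int c"]
        by (simp only: n_def)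
    qed
    define r where "r u = round (dot d u h / n)" for u
    have r: "(dot d u h / n - of_int (r u))\<^sup>2 * n < I / 2" for u
    proof -
      have "\<bar>dot d u h / n - of_int (r u)\<bar> \<le> 1 / 2"
        unfolding r_def by (metis abs_minus_commute of_int_round_abs_le)
      hence "(dot d u h / n - of_int (r u))\<^sup>2 \<le> (1 / 2)\<^sup>2"
        using abs_le_square_iff[of "dot d u h / n - of_int (r u)" "1 / 2"] by simp
      hence "(dot d u h / n - of_int (r u))\<^sup>2 * n \<le> (1 / 2)\<^sup>2 * n"
        using n by (intro mult_right_mono) auto
      also have "\<dots> < I / 2" using n by (simp add: power2_eq_square)
      finally show ?thesis .
    qed
    \<comment> \<open>The smallest change that makes the value at \<open>h\<close> an integer.
      Adding the functional of \<open>s1 / n * h\<close> to \<open>\<phi>\<close> achieves it, so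
      that \<open>\<phi>1\<close> modulo 1 depends only on the projection
      \<open>P u\<close>.\<close>
    define s1 where "s1 = of_int (round (\<phi> h)) - \<phi> h"
    have s1: "\<bar>s1\<bar> \<le> 1 / 2" unfolding s1_def by (rule of_int_round_abs_le)
    define \<phi>1 where "\<phi>1 u = \<phi> u + s1 * dot d h u / n" for u
    have \<phi>1diff: "\<phi>1 (\<lambda>i. u i - v i) - (\<phi>1 u - \<phi>1 v) \<in> \<int>" if "u \<in> M" "v \<in> M" for u v
      using \<phi>diff[OF that] by (simp add: \<phi>1_def dot_diff_right algebra_simps diff_divide_distrib)
    \<comment> \<open>When \<open>P u\<close> is null, the reduced vector \<open>?v\<close> is
      shorter than the infimum allows for a non-null vector. So \<open>u\<close> is an integer
      multiple of \<open>h\<close> up to a null vector, and \<open>\<phi>1\<close> is integral at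
      both parts modulo 1.\<close>
    have \<phi>1null: "\<phi>1 u \<in> \<int>" if u: "u \<in> M" "dot d (P u) (P u) = 0" for u
    proof -
      let ?v = "\<lambda>i. u i - of_int (r u) * h i"
      have v: "?v \<in> M" "\<phi> ?v - (\<phi> u - of_int (r u) * \<phi> h) \<in> \<int>" using step[OF u(1)] by auto
      have "dot d ?v ?v < I" using norm_step[of u "r u"] r[of u] u \<open>l \<le> I\<close> l by linarith
      hence "dot d ?v ?v = 0" using I_le[OF v(1)] by linarith
      hence "\<phi> ?v \<in> \<int>" and "dot d u h / n = of_int (r u)"
        using \<phi>null[OF v(1)] norm_step[of u "r u"] u n by auto
      from Ints_diff[OF this(1) v(2)] have "\<phi> u - of_int (r u) * \<phi> h \<in> \<int>" by simp
      moreover have "\<phi>1 u = \<phi> u + s1 * (dot d u h / n)"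
        by (simp add: \<phi>1_def dot_commute[of d h u])
      hence "\<phi>1 u = (\<phi> u - of_int (r u) * \<phi> h) + of_int (r u * round (\<phi> h))"
        unfolding \<open>dot d u h / n = of_int (r u)\<close> by (simp add: s1_def algebra_simps)
      ultimately show ?thesis by (metis Ints_add Ints_of_int)
    qed
    have \<phi>1cong: "\<phi>1 u - \<phi>1 v \<in> \<int>" if "u \<in> M" "v \<in> M" "P u = P v" for u v
    proof -
      have "dot d (P (\<lambda>i. u i - v i)) (P (\<lambda>i. u i - v i)) = 0"
        unfolding Pdiff that(3) by (simp add: dot_def)
      from Ints_diff[OF \<phi>1null[OF diff[OF that(1,2)] this] \<phi>1diff[OF that(1,2)]]
      show ?thesis by simp
    qed
    define rep where "rep u' = (SOME u. u \<in> M \<and> P u = u')" for u'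
    have rep: "rep (P u) \<in> M" "P (rep (P u)) = P u" if "u \<in> M" for u
      using someI[of "\<lambda>v. v \<in> M \<and> P v = P u" u] that by (auto simp: rep_def)
    have \<phi>1rep: "\<phi>1 (rep (P u)) - \<phi>1 u \<in> \<int>" if "u \<in> M" for u
      by (intro \<phi>1cong rep that)
    define w' where "w' = w(k := (\<lambda>i. h i / sqrt n))"
    have Pw: "dot d (P u) (w i) = 0" if "u \<in> M" "i < k" for u i
      unfolding P_def dot_diff_left dot_scale_left by (simp add: orthM that h)
    have "\<exists>s. (\<forall>i<Suc k. dot d s (w' i) = 0) \<and> (\<forall>u\<in>P ` M. \<phi>1 (rep u) + dot d s u \<in> \<int>)
             \<and> dot d s s \<le> (2 ^ m - 1) / (4 * (l / 2))"
    proof (rule Suc.IH)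
      show "Suc k + m = d" using Suc.prems(1) by simp
      show "dot d (w' i) (w' j) = (if i = j then 1 else 0)" if "i < Suc k" "j < Suc k" for i j
        using that ortho orthM[OF h(1)] n dot_commute[of d "w i" h]
        by (auto simp: w'_def dot_divide_left dot_divide_right less_Suc_eq simp flip: n_def)
      show "(\<lambda>i. u i - v i) \<in> P ` M" if "u \<in> P ` M" "v \<in> P ` M" for u v
        using that diff by (auto simp flip: Pdiff)
      show "dot d u (w' i) = 0" if "u \<in> P ` M" "i < Suc k" for u i
        using that Pw Ph by (auto simp: w'_def dot_divide_right less_Suc_eq)
      show "0 < l / 2" using l by simp
      show "l / 2 \<le> dot d u u" if u: "u \<in> P ` M" "dot d u u \<noteq> 0" for u
      proof -
        obtain v where v: "v \<in> M" "u = P v" using u by auto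
        let ?v = "\<lambda>i. v i - of_int (r v) * h i"
        \<comment> \<open>If the projection is not null, neither is the reduced vector, whose
          squared length is thus at least \<open>I\<close>. Its component along \<open>h\<close>
          accounts for less than \<open>I / 2\<close>, so the projection keeps at least
          \<open>I / 2\<close>.\<close>
        have "dot d ?v ?v \<noteq> 0"
          using norm_step[of v "r v"] u v n dot_self_nonneg[of d "P v"]
          by (metis add_nonneg_eq_0_iff mult_nonneg_nonneg less_imp_le zero_le_power2)
        hence "I \<le> dot d ?v ?v" using step[OF v(1)] I_le by blast
        then show ?thesis
          using norm_step[of v "r v"] r[of v] \<open>l \<le> I\<close> unfolding v(2) by linarith
      qed
      show "\<phi>1 (rep (\<lambda>i. u i - v i)) - (\<phi>1 (rep u) - \<phi>1 (rep v)) \<in> \<int>"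
        if uv: "u \<in> P ` M" "v \<in> P ` M" for u v
      proof -
        obtain a b where ab: "a \<in> M" "u = P a" "b \<in> M" "v = P b"
          using uv by blast
        have 1: "\<phi>1 (rep (\<lambda>i. u i - v i)) - \<phi>1 (\<lambda>i. a i - b i) \<in> \<int>"
          using \<phi>1rep[OF diff[OF ab(1,3)]] by (simp add: ab Pdiff)
        have "(\<phi>1 (rep (\<lambda>i. u i - v i)) - \<phi>1 (\<lambda>i. a i - b i)) + (\<phi>1 (\<lambda>i. a i - b i) - (\<phi>1 a - \<phi>1 b))
            - (\<phi>1 (rep u) - \<phi>1 a) + (\<phi>1 (rep v) - \<phi>1 b) \<in> \<int>"
          using Ints_add[OF Ints_diff[OF Ints_add[OF 1 \<phi>1diff[OF ab(1,3)]] \<phi>1rep[OF ab(1)]]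
                \<phi>1rep[OF ab(3)]]
          unfolding ab(2,4) .
        then show ?thesis by (simp add: algebra_simps)
      qed
      show "\<phi>1 (rep u) \<in> \<int>" if "u \<in> P ` M" "dot d u u = 0" for u
        using that rep by (auto intro: \<phi>1null)
    qed
    then obtain s where s: "\<And>i. i < Suc k \<Longrightarrow> dot d s (w' i) = 0"
      "\<And>u. u \<in> M \<Longrightarrow> \<phi>1 (rep (P u)) + dot d s (P u) \<in> \<int>" "dot d s s \<le> (2 ^ m - 1) / (4 * (l / 2))"
      by auto
    have sh: "dot d s h = 0"
      using s(1)[of k] n by (simp add: w'_def dot_divide_right)
    define t where "t = (\<lambda>i. s i + s1 / n * h i)"
    show ?thesis
    proof (intro exI[of _ t] conjI ballI allI impI)
      show "dot d t (w i) = 0" if "i < k" for i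
        using s(1)[of i] orthM[OF h(1) that] that
        unfolding t_def dot_add_left dot_scale_left by (simp add: w'_def)
      show "\<phi> u + dot d t u \<in> \<int>" if "u \<in> M" for u
      proof -
        have "dot d s (P u) = dot d s u"
          unfolding P_def dot_diff_right dot_scale_right by (simp add: sh)
        hence "\<phi> u + dot d t u = (\<phi>1 (rep (P u)) + dot d s (P u)) - (\<phi>1 (rep (P u)) - \<phi>1 u)"
          unfolding t_def dot_add_left dot_scale_left by (simp add: \<phi>1_def)
        then show ?thesis
          using Ints_diff[OF s(2)[OF that] \<phi>1rep[OF that]] by (simp only:)
      qed
      \<comment> \<open>The two pieces of \<open>t\<close> are orthogonal, so the costs add: 1 / (4
        l) for rounding along \<open>h\<close> and (2^m - 1) / (2 l) from the projected set with
        minimum \<open>l / 2\<close>.\<close>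
      have "dot d t t = s1\<^sup>2 / n + dot d s s"
        unfolding t_def dot_self_add_orthogonal[OF sh] n_def[symmetric]
        using n by (simp add: power2_eq_square)
      also have "s1\<^sup>2 / n \<le> (1 / 2)\<^sup>2 / l"
        using s1 n l \<open>l \<le> I\<close> abs_le_square_iff[of s1 "1 / 2"] by (intro frac_le) auto
      also have "(1 / 2)\<^sup>2 / l + dot d s s \<le> (1 / 2)\<^sup>2 / l + (2 ^ m - 1) / (4 * (l / 2))"
        using s(3) by simp
      also have "\<dots> = (2 ^ Suc m - 1) / (4 * l)"
        using l by (simp add: field_simps power2_eq_square)
      finally show "dot d t t \<le> (2 ^ Suc m - 1) / (4 * l)" by simp
    qed
  qed
qed

section \<open>Lattices, dual lattices and the covering radius\<close>

lemma dot_restrict_left [simp]: "dot d (restrict x {..<d}) y = dot d x y"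
  by (simp add: dot_def)

lemma dot_restrict_right [simp]: "dot d x (restrict y {..<d}) = dot d x y"
  by (simp add: dot_def)

lemma restrict_in_eucl_space [simp]: "restrict x {..<d} \<in> eucl_space d"
  by (auto simp: eucl_space_def)

lemma eucl_space_eqI:
  assumes "x \<in> eucl_space d" "y \<in> eucl_space d" "\<And>i. i < d \<Longrightarrow> x i = y i"
  shows "x = y"
  using assms unfolding eucl_space_def by (intro PiE_ext) auto

lemma eucl_space_restrict: "x \<in> eucl_space d \<Longrightarrow> restrict x {..<d} = x"
  by (auto simp: eucl_space_def)

lemma zero_vector_in_eucl_space: "zero_vector d \<in> eucl_space d"
  unfolding zero_vector_def by simp

lemma eq_zero_vector_iff: "x \<in> eucl_space d \<Longrightarrow> x = zero_vector d \<longleftrightarrow> dot d x x = 0"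
  using eucl_space_eqI[of x d "zero_vector d"] zero_vector_in_eucl_space
  by (auto simp: dot_self_eq_0_iff zero_vector_def)

lemma L2_set_eq_sqrt_dot: "L2_set x {..<d} = sqrt (dot d x x)"
  by (simp add: L2_set_def dot_def power2_eq_square)

text \<open>This is inversion of the basis matrix: expanding the unit vectors in \<open>b\<close>
  gives the coefficients \<open>A\<close>, whose columns are the dual vectors \<open>h j\<close>.
  Uniqueness of coefficients, applied to the expansion of each \<open>b i\<close>, gives
  biorthogonality.\<close>

lemma dual_basis_exists:
  assumes b: "is_basis d b"
  obtains h where "\<And>j. j < d \<Longrightarrow> h j \<in> eucl_space d"
    and "\<And>i j. i < d \<Longrightarrow> j < d \<Longrightarrow> dot d (h j) (b i) = (if i = j then 1 else 0)"
    and "\<And>x. x \<in> eucl_space d \<Longrightarrow> x = lin_comb d (\<lambda>j. dot d (h j) x) b"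
proof -
  have "\<exists>a. (\<lambda>l\<in>{..<d}. if l = i then 1 else 0) = lin_comb d a b" for i
    using b restrict_in_eucl_space unfolding is_basis_def by blast
  then obtain A where A: "\<And>i. (\<lambda>l\<in>{..<d}. if l = i then 1 else 0) = lin_comb d (A i) b"
    by metis
  have A': "(\<Sum>j<d. A i j * b j l) = (if l = i then 1 else 0)" if "l < d" for i l
    using fun_cong[OF A[of i], of l] that by (simp add: lin_comb_def)
  define h where "h j = (\<lambda>i\<in>{..<d}. A i j)" for j
  have expand: "x = lin_comb d (\<lambda>j. dot d (h j) x) b" if x: "x \<in> eucl_space d" for x
  proof (rule eucl_space_eqI[OF x])
    show "lin_comb d (\<lambda>j. dot d (h j) x) b \<in> eucl_space d"
      by (simp add: lin_comb_def)
    fix l assume l: "l < d"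
    have "lin_comb d (\<lambda>j. dot d (h j) x) b l = (\<Sum>j<d. \<Sum>i<d. x i * (A i j * b j l))"
      using l by (simp add: lin_comb_def h_def dot_def sum_distrib_left sum_distrib_right mult_ac)
    also have "\<dots> = (\<Sum>i<d. \<Sum>j<d. x i * (A i j * b j l))"
      by (rule sum.swap)
    also have "\<dots> = (\<Sum>i<d. x i * (if l = i then 1 else 0))"
      using A'[OF l] by (simp flip: sum_distrib_left)
    also have "\<dots> = (\<Sum>i<d. if l = i then x i else 0)"
      by (intro sum.cong) auto
    also have "\<dots> = x l" using l by simp
    finally show "x l = lin_comb d (\<lambda>j. dot d (h j) x) b l" by simp
  qed
  have dual: "dot d (h j) (b i) = (if i = j then 1 else 0)" if i: "i < d" and j: "j < d" for i j
  proof -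
    have bi: "b i \<in> eucl_space d" using b i by (auto simp: is_basis_def)
    have "lin_comb d (\<lambda>j. dot d (h j) (b i) - (if i = j then 1 else 0)) b = zero_vector d"
    proof (rule eucl_space_eqI)
      fix l assume l: "l < d"
      have "b i l = (\<Sum>j<d. dot d (h j) (b i) * b j l)"
        using fun_cong[OF expand[OF bi], of l] l by (simp add: lin_comb_def)
      moreover have "(\<Sum>j<d. (if i = j then 1 else 0) * b j l) = (\<Sum>j<d. if i = j then b j l else 0)"
        by (intro sum.cong) auto
      ultimately show "lin_comb d (\<lambda>j. dot d (h j) (b i) - (if i = j then 1 else 0)) b l = zero_vector d l"
        using l i by (simp add: lin_comb_def zero_vector_def left_diff_distrib sum_subtractf)
    qed (auto simp: lin_comb_def zero_vector_def)
    then show ?thesis using b j unfolding is_basis_def by fastforce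
  qed
  show thesis
    by (rule that[of h]) (use expand dual in \<open>auto simp: h_def\<close>)
qed

text \<open>Describes a lattice by finitely many integrality conditions instead of by generators. In
  this form closure under addition, the bidual inclusion and finiteness in the cube can be read off
  without returning to a basis.\<close>

lemma lattice_by_coordinates:
  assumes "is_lattice d L"
  obtains h where "L = {x \<in> eucl_space d. \<forall>j<d. dot d (h j) x \<in> \<int>}"
    and "\<forall>j<d. h j \<in> eucl_space d \<and> dot d (h j) (h j) \<noteq> 0"
    and "\<forall>x\<in>eucl_space d. \<forall>y\<in>eucl_space d. (\<forall>j<d. dot d (h j) x = dot d (h j) y) \<longrightarrow> x = y"
proof -
  obtain b where b: "is_basis d b"
    and L: "L = {lin_comb d (\<lambda>j. of_int (k j)) b |k :: nat \<Rightarrow> int. True}"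
    using assms by (auto simp: is_lattice_def)
  obtain h where h: "\<And>j. j < d \<Longrightarrow> h j \<in> eucl_space d"
    "\<And>i j. i < d \<Longrightarrow> j < d \<Longrightarrow> dot d (h j) (b i) = (if i = j then 1 else 0)"
    "\<And>x. x \<in> eucl_space d \<Longrightarrow> x = lin_comb d (\<lambda>j. dot d (h j) x) b"
    using dual_basis_exists[OF b] by blast
  have dot_lc: "dot d (h j) (lin_comb d a b) = a j" if j: "j < d" for a j
  proof -
    have "dot d (h j) (lin_comb d a b) = (\<Sum>i<d. \<Sum>k<d. a k * (h j i * b k i))"
      by (simp add: dot_def lin_comb_def sum_distrib_left mult_ac)
    also have "\<dots> = (\<Sum>k<d. a k * dot d (h j) (b k))"
      by (subst sum.swap) (simp add: dot_def sum_distrib_left)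
    also have "\<dots> = (\<Sum>k<d. if k = j then a k else 0)"
      using h(2) j by (intro sum.cong) auto
    also have "\<dots> = a j" using j by simp
    finally show ?thesis .
  qed
  have lc_cong: "lin_comb d a b = lin_comb d a' b" if "\<And>j. j < d \<Longrightarrow> a j = a' j" for a a'
    using that by (auto simp: lin_comb_def intro!: sum.cong)
  show thesis
  proof (rule that)
    show "L = {x \<in> eucl_space d. \<forall>j<d. dot d (h j) x \<in> \<int>}"
    proof (intro equalityI subsetI)
      fix x assume "x \<in> L"
      then show "x \<in> {x \<in> eucl_space d. \<forall>j<d. dot d (h j) x \<in> \<int>}"
        unfolding L using dot_lc by (auto simp: lin_comb_def[of d])
    next
      fix x assume x: "x \<in> {x \<in> eucl_space d. \<forall>j<d. dot d (h j) x \<in> \<int>}"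
      hence "x = lin_comb d (\<lambda>j. of_int \<lfloor>dot d (h j) x\<rfloor>) b"
        using lc_cong[of "\<lambda>j. dot d (h j) x" "\<lambda>j. of_int \<lfloor>dot d (h j) x\<rfloor>"] h(3)[of x]
        by (auto elim!: Ints_cases)
      then show "x \<in> L"
        unfolding L by (intro CollectI exI[of _ "\<lambda>j. \<lfloor>dot d (h j) x\<rfloor>"]) simp
    qed
    show "\<forall>j<d. h j \<in> eucl_space d \<and> dot d (h j) (h j) \<noteq> 0"
    proof (intro allI impI conjI)
      show "dot d (h j) (h j) \<noteq> 0" if "j < d" for j
        using h(2)[OF that that] dot_eq_0_if_null[of d "h j" "b j"] by auto
    qed (rule h)
    show "\<forall>x\<in>eucl_space d. \<forall>y\<in>eucl_space d. (\<forall>j<d. dot d (h j) x = dot d (h j) y) \<longrightarrow> x = y"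
    proof (intro ballI impI)
      fix x y assume "x \<in> eucl_space d" "y \<in> eucl_space d" "\<forall>j<d. dot d (h j) x = dot d (h j) y"
      then show "x = y"
        using h(3)[of x] h(3)[of y] lc_cong[of "\<lambda>j. dot d (h j) x" "\<lambda>j. dot d (h j) y"] by auto
    qed
  qed
qed

lemma lattice_subset:
  assumes "is_lattice d L"
  shows "L \<subseteq> eucl_space d"
proof -
  obtain b where "L = {lin_comb d (\<lambda>j. of_int (k j)) b |k :: nat \<Rightarrow> int. True}"
    using assms unfolding is_lattice_def by blast
  then show ?thesis by (auto simp: lin_comb_def)
qed

lemma lattice_add_closed:
  assumes "is_lattice d L" "x \<in> L" "y \<in> L"
  shows "(\<lambda>i\<in>{..<d}. x i + y i) \<in> L"
proof -
  obtain h where L: "L = {x \<in> eucl_space d. \<forall>j<d. dot d (h j) x \<in> \<int>}"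
    using lattice_by_coordinates[OF assms(1)] by blast
  have "dot d (h j) (\<lambda>i. x i + y i) = dot d (h j) x + dot d (h j) y" for j
    using dot_lincomb_right[of d "h j" 1 x 1 y] by simp
  with assms show ?thesis unfolding L by auto
qed

lemma lattice_diff_closed:
  assumes "is_lattice d L" "x \<in> L" "y \<in> L"
  shows "(\<lambda>i\<in>{..<d}. x i - y i) \<in> L"
proof -
  obtain h where L: "L = {x \<in> eucl_space d. \<forall>j<d. dot d (h j) x \<in> \<int>}"
    using lattice_by_coordinates[OF assms(1)] by blast
  with assms show ?thesis by (auto simp: dot_diff_right)
qed

text \<open>The coordinate functionals themselves belong to the dual lattice, and integrality on
  them already characterises \<open>L\<close>.\<close>

lemma dual_of_dual_subset:
  assumes "is_lattice d L" "x \<in> eucl_space d" "\<And>h. h \<in> dual_lattice d L \<Longrightarrow> dot d h x \<in> \<int>"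
  shows "x \<in> L"
proof -
  obtain h where L: "L = {x \<in> eucl_space d. \<forall>j<d. dot d (h j) x \<in> \<int>}"
    and h: "\<forall>j<d. h j \<in> eucl_space d \<and> dot d (h j) (h j) \<noteq> 0"
    using lattice_by_coordinates[OF assms(1)] by blast
  have "h j \<in> dual_lattice d L" if "j < d" for j
    unfolding dual_lattice_def using h L that by auto
  with assms(2,3) show ?thesis unfolding L by auto
qed

text \<open>Integer coordinates determine a lattice point, and on the cube the \<open>j\<close>-th
  coordinate is bounded by the sum of the \<open>\<bar>h j i\<bar>\<close>; so the points inject
  into a finite box of integer vectors.\<close>

lemma finite_lattice_points:
  assumes "is_lattice d L"
  shows "finite (lattice_points d L)"
proof -
  obtain h where L: "L = {x \<in> eucl_space d. \<forall>j<d. dot d (h j) x \<in> \<int>}"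
    and inj: "\<forall>x\<in>eucl_space d. \<forall>y\<in>eucl_space d. (\<forall>j<d. dot d (h j) x = dot d (h j) y) \<longrightarrow> x = y"
    using lattice_by_coordinates[OF assms] by blast
  define f where "f x = (\<lambda>j\<in>{..<d}. \<lfloor>dot d (h j) x\<rfloor>)" for x
  define K where "K j = \<lceil>\<Sum>i<d. \<bar>h j i\<bar>\<rceil>" for j
  have "inj_on f L"
  proof (rule inj_onI)
    fix x y assume x: "x \<in> L" and y: "y \<in> L" and eq: "f x = f y"
    have "dot d (h j) x = dot d (h j) y" if j: "j < d" for j
    proof -
      have "\<lfloor>dot d (h j) x\<rfloor> = \<lfloor>dot d (h j) y\<rfloor>"
        using fun_cong[OF eq, of j] j by (simp add: f_def)
      moreover have "dot d (h j) x \<in> \<int>" "dot d (h j) y \<in> \<int>"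
        using x y j L by auto
      ultimately show ?thesis by (auto elim!: Ints_cases)
    qed
    with inj x y L show "x = y" by auto
  qed
  hence "inj_on f (lattice_points d L)" 
    by (rule inj_on_subset) (auto simp: lattice_points_def)
  moreover have "f ` lattice_points d L \<subseteq> (\<Pi>\<^sub>E j\<in>{..<d}. {- K j - 1..K j})"
  proof (intro image_subsetI)
    fix x assume x: "x \<in> lattice_points d L"
    hence xi: "\<bar>x i\<bar> \<le> 1" if "i < d" for i
      using that by (force simp: lattice_points_def unit_cube_def PiE_iff)
    have "\<lfloor>dot d (h j) x\<rfloor> \<in> {- K j - 1..K j}" for j
    proof -
      have "\<bar>dot d (h j) x\<bar> \<le> (\<Sum>i<d. \<bar>h j i * x i\<bar>)"
        unfolding dot_def by (rule sum_abs)
      also have "\<dots> \<le> (\<Sum>i<d. \<bar>h j i\<bar>)"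
        using xi by (intro sum_mono) (auto simp: abs_mult intro!: mult_left_le)
      also have "\<dots> \<le> of_int (K j)" by (simp add: K_def)
      finally have "\<bar>dot d (h j) x\<bar> \<le> of_int (K j)" .
      then show ?thesis by auto linarith+
    qed
    then show "f x \<in> (\<Pi>\<^sub>E j\<in>{..<d}. {- K j - 1..K j})"
      by (auto simp: f_def)
  qed
  moreover have "finite (\<Pi>\<^sub>E j\<in>{..<d}. {- K j - 1..K j})"
    by (intro finite_PiE) auto
  ultimately show ?thesis
    using finite_imageD finite_subset by blast
qed

lemma dual_lattice_coord_Ints:
  assumes "integration_lattice d L" "h \<in> dual_lattice d L" "i < d"
  shows "h i \<in> \<int>"
proof -
  let ?e = "\<lambda>l\<in>{..<d}. if l = i then 1 else 0 :: real"
  have "?e \<in> ({..<d} \<rightarrow>\<^sub>E \<int>)" by auto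
  with assms(1) have "?e \<in> L" unfolding integration_lattice_def by blast
  hence "dot d h ?e \<in> \<int>" using assms(2) by (auto simp: dual_lattice_def)
  moreover have "dot d h ?e = (\<Sum>l<d. if l = i then h l else 0)"
    unfolding dot_def by (intro sum.cong) auto
  ultimately show ?thesis using assms(3) by simp
qed

text \<open>\<open>LEAST\<close> on the reals says nothing unless a minimum exists. Here the values
  are square roots of naturals, so well-ordering supplies one.\<close>

lemma Least_length_attained:
  fixes f :: "'a \<Rightarrow> real"
  assumes "x \<in> A" "\<And>x. x \<in> A \<Longrightarrow> \<exists>n::nat. f x = sqrt (real n)"
  shows "\<exists>a\<in>A. (LEAST r. \<exists>x\<in>A. r = f x) = f a \<and> (\<forall>x\<in>A. f a \<le> f x)"
proof -
  define n where "n = (LEAST n. \<exists>x\<in>A. f x = sqrt (real n))"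
  have "\<exists>n. \<exists>x\<in>A. f x = sqrt (real n)" using assms by blast
  from LeastI_ex[OF this] obtain a where a: "a \<in> A" "f a = sqrt (real n)"
    by (auto simp: n_def)
  have "f a \<le> f x" if "x \<in> A" for x
  proof -
    obtain m :: nat where m: "f x = sqrt (real m)" using assms(2) \<open>x \<in> A\<close> by blast
    have "n \<le> m" unfolding n_def by (rule Least_le) (use m that in auto)
    with a m show ?thesis by simp
  qed
  moreover from this have "(LEAST r. \<exists>x\<in>A. r = f x) = f a"
    using \<open>a \<in> A\<close> by (intro Least_equality) blast+
  ultimately show ?thesis using a by blast
qed

text \<open>Dual vectors have integer coordinates because the integer vectors lie in
  \<open>L\<close>, so squared lengths are naturals; \<open>g 0\<close> shows that a nonzero dual
  vector exists when \<open>d\<close> is positive. The vector \<open>h\<close> is the slab normal in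
  the lower bounds, and its minimality drives the covering bound.\<close>

lemma spectral_test_attained:
  assumes "d \<ge> 1" "integration_lattice d L"
  obtains h where "h \<in> dual_lattice d L" "dot d h h \<ge> 1"
    "spectral_test d L = 1 / sqrt (dot d h h)"
    "\<And>u. u \<in> dual_lattice d L \<Longrightarrow> dot d u u \<noteq> 0 \<Longrightarrow> dot d h h \<le> dot d u u"
proof -
  have lat: "is_lattice d L" using assms by (simp add: integration_lattice_def)
  let ?A = "dual_lattice d L - {zero_vector d}"
  obtain g where L: "L = {x \<in> eucl_space d. \<forall>j<d. dot d (g j) x \<in> \<int>}"
    and g: "\<forall>j<d. g j \<in> eucl_space d \<and> dot d (g j) (g j) \<noteq> 0"
    using lattice_by_coordinates[OF lat] by blast
  have A: "u \<in> ?A \<longleftrightarrow> u \<in> dual_lattice d L \<and> dot d u u \<noteq> 0" for u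
    using eq_zero_vector_iff[of u d] by (auto simp: dual_lattice_def)
  have "g 0 \<in> ?A"
    unfolding A using g assms L by (auto simp: dual_lattice_def)
  moreover have nat: "\<exists>n::nat. dot d u u = real n" if "u \<in> dual_lattice d L" for u
  proof -
    have "dot d u u \<in> \<int>"
      unfolding dot_def using dual_lattice_coord_Ints[OF assms(2) that]
      by (intro Ints_sum) auto
    with dot_self_nonneg[of d u] show ?thesis
      by (metis Ints_cases of_int_0_le_iff of_int_of_nat_eq nonneg_int_cases)
  qed
  hence "\<exists>n::nat. L2_set u {..<d} = sqrt (real n)" if "u \<in> ?A" for u
    unfolding L2_set_eq_sqrt_dot using that by auto
  ultimately obtain h where h: "h \<in> ?A"
    "(LEAST r. \<exists>x\<in>?A. r = L2_set x {..<d}) = L2_set h {..<d}"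
    "\<And>x. x \<in> ?A \<Longrightarrow> L2_set h {..<d} \<le> L2_set x {..<d}"
    using Least_length_attained[of "g 0" ?A "\<lambda>x. L2_set x {..<d}"] by blast
  show thesis
  proof (rule that)
    show "h \<in> dual_lattice d L" using h by auto
    show "dot d h h \<ge> 1"
      using nat[of h] h(1) unfolding A by (auto simp: Suc_le_eq)
    show "spectral_test d L = 1 / sqrt (dot d h h)"
      unfolding spectral_test_def h(2) by (simp add: L2_set_eq_sqrt_dot)
    show "dot d h h \<le> dot d u u" if "u \<in> dual_lattice d L" "dot d u u \<noteq> 0" for u
      using h(3)[of u] that unfolding A L2_set_eq_sqrt_dot by simp
  qed
qed

text \<open>Apply the correction to the functional \<open>u\<close> to \<open>u \<cdot> x\<close>.
  The resulting \<open>s\<close> makes \<open>x + s\<close> integral against every dual vector, so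
  \<open>x + s\<close> lies in \<open>L\<close>, and each coordinate of \<open>s\<close> is bounded
  by its Euclidean length.\<close>

lemma lattice_covering:
  assumes "d \<ge> 1" "integration_lattice d L" "x \<in> eucl_space d"
  shows "\<exists>g\<in>L. \<forall>i<d. \<bar>x i - g i\<bar> \<le> 2 ^ d / 4 * spectral_test d L"
proof -
  have lat: "is_lattice d L" using assms by (simp add: integration_lattice_def)
  obtain h where h: "h \<in> dual_lattice d L" "dot d h h \<ge> 1"
    "spectral_test d L = 1 / sqrt (dot d h h)"
    "\<And>u. u \<in> dual_lattice d L \<Longrightarrow> dot d u u \<noteq> 0 \<Longrightarrow> dot d h h \<le> dot d u u"
    using spectral_test_attained[OF assms(1,2)] by metis
  \<comment> \<open>Unlike \<open>dual_lattice\<close>, this set is not confined to extensional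
    functions, which makes it closed under pointwise differences.\<close>
  define M where "M = {u. \<forall>g\<in>L. dot d u g \<in> \<int>}"
  have M: "u \<in> M \<longleftrightarrow> restrict u {..<d} \<in> dual_lattice d L" for u
    by (auto simp: M_def dual_lattice_def)
  have "\<exists>s. (\<forall>i<0::nat. dot d s (undefined i) = 0) \<and> (\<forall>u\<in>M. dot d u x + dot d s u \<in> \<int>)
             \<and> dot d s s \<le> (2 ^ d - 1) / (4 * dot d h h)"
  proof (rule integral_functional_correction[where k = 0 and w = undefined])
    show "(\<lambda>i. u i - v i) \<in> M" if "u \<in> M" "v \<in> M" for u v
      using that by (auto simp: M_def dot_diff_left)
    show "dot d h h \<le> dot d u u" if "u \<in> M" "dot d u u \<noteq> 0" for u
      using h(4)[of "restrict u {..<d}"] that by (auto simp: M)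
    show "dot d u x \<in> \<int>" if "dot d u u = 0" for u
      using dot_eq_0_if_null[OF that] by simp
  qed (use h in \<open>auto simp: dot_diff_left\<close>)
  then obtain s where s: "\<And>u. u \<in> M \<Longrightarrow> dot d u x + dot d s u \<in> \<int>"
    "dot d s s \<le> (2 ^ d - 1) / (4 * dot d h h)" by blast
  define g where "g = (\<lambda>i\<in>{..<d}. x i + s i)"
  have "g \<in> L"
  proof (rule dual_of_dual_subset[OF lat])
    fix u assume "u \<in> dual_lattice d L"
    hence "u \<in> M" by (auto simp: M_def dual_lattice_def)
    from s(1)[OF this] show "dot d u g \<in> \<int>"
      using dot_lincomb_right[of d u 1 x 1 s] dot_commute[of d s u] by (simp add: g_def)
  qed (simp add: g_def)
  moreover have "\<bar>x i - g i\<bar> \<le> 2 ^ d / 4 * spectral_test d L" if "i < d" for i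
  proof -
    \<comment> \<open>This square turns the bound on the squared length of \<open>s\<close> into the
      perfect square of \<open>2 ^ d / 4 * spectral_test d L\<close>.\<close>
    have "0 \<le> (2 ^ d - 2 :: real)\<^sup>2" by simp
    hence "2 ^ d - 1 \<le> (2 ^ d)\<^sup>2 / (4 :: real)" by (simp add: power2_eq_square algebra_simps)
    hence "(2 ^ d - 1) / (4 * dot d h h) \<le> (2 ^ d)\<^sup>2 / 4 / (4 * dot d h h)"
      using h(2) by (intro divide_right_mono) auto
    also have "\<dots> = (2 ^ d / 4 * spectral_test d L)\<^sup>2"
      using h(2) by (simp add: h(3) power_mult_distrib power_divide)
    finally have "dot d s s \<le> (2 ^ d / 4 * spectral_test d L)\<^sup>2" using s(2) by simp
    moreover have "(s i)\<^sup>2 \<le> dot d s s"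
      unfolding dot_def power2_eq_square using that by (intro member_le_sum) auto
    ultimately have "(s i)\<^sup>2 \<le> (2 ^ d / 4 * spectral_test d L)\<^sup>2" by linarith
    moreover have "0 \<le> 2 ^ d / 4 * spectral_test d L" using h by simp
    ultimately have "\<bar>s i\<bar> \<le> 2 ^ d / 4 * spectral_test d L"
      by (metis abs_le_square_iff abs_of_nonneg)
    then show ?thesis using that by (simp add: g_def)
  qed
  ultimately show ?thesis by blast
qed

section \<open>Erosion and dilation of convex sets\<close>

abbreviation leb :: "nat \<Rightarrow> (nat \<Rightarrow> real) measure" where
  "leb d \<equiv> \<Pi>\<^sub>M i\<in>{..<d}. lborel"

interpretation lborel_prod: product_sigma_finite "\<lambda>_::nat. lborel :: real measure"
  by standard

lemma space_leb: "space (leb d) = eucl_space d"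
  by (simp add: space_PiM eucl_space_def)

lemma eucl_space_undefined: "x \<in> eucl_space d \<Longrightarrow> d \<le> i \<Longrightarrow> x i = undefined"
  by (auto simp: eucl_space_def PiE_iff extensional_def)

lemma fun_upd_in_eucl_space_iff: "k < d \<Longrightarrow> x(k := y) \<in> eucl_space d \<longleftrightarrow> x \<in> eucl_space d"
  by (auto simp: eucl_space_def PiE_iff extensional_def)

lemma emeasure_box:
  fixes I :: "nat set"
  assumes "finite I" "a \<le> b"
  shows "emeasure (\<Pi>\<^sub>M i\<in>I. lborel) (I \<rightarrow>\<^sub>E {a..b::real}) = ennreal ((b - a) ^ card I)"
proof -
  have "emeasure (\<Pi>\<^sub>M i\<in>I. lborel) (I \<rightarrow>\<^sub>E {a..b::real}) = (\<Prod>i\<in>I. emeasure lborel {a..b})"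
    using assms by (intro lborel_prod.emeasure_PiM) auto
  with assms show ?thesis by (simp add: ennreal_power)
qed

lemma sets_box [measurable]:
  "finite (I :: nat set) \<Longrightarrow> (I \<rightarrow>\<^sub>E {a..b::real}) \<in> sets (\<Pi>\<^sub>M i\<in>I. lborel)"
  by (intro sets_PiM_I_finite) auto

text \<open>A point of \<open>J\<close> further than \<open>\<delta>\<close> from both the infimum
  and the supremum survives, whether or not \<open>J\<close> contains its end points. What is lost
  lies in two intervals of length \<open>\<delta>\<close>.\<close>

lemma interval_erosion_1d:
  fixes J :: "real set"
  assumes J: "J \<subseteq> {a..b}" "J \<in> sets borel" "0 \<le> \<delta>"
    and conv: "\<And>x y z. x \<in> J \<Longrightarrow> y \<in> J \<Longrightarrow> x \<le> z \<Longrightarrow> z \<le> y \<Longrightarrow> z \<in> J"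
  shows "emeasure lborel J \<le> emeasure lborel {y. y + \<delta> \<in> J \<and> y - \<delta> \<in> J} + ennreal (2 * \<delta>)"
proof (cases "J = {}")
  case False
  let ?s = "Inf J" and ?t = "Sup J"
  have bdd: "bdd_below J" "bdd_above J"
    using J(1) by (meson atLeastAtMost_iff bdd_below.I subsetD, meson atLeastAtMost_iff bdd_above.I subsetD)
  have E: "{y. y + \<delta> \<in> J \<and> y - \<delta> \<in> J} \<in> sets borel"
    using J(2) by measurable
  have "J \<subseteq> {y. y + \<delta> \<in> J \<and> y - \<delta> \<in> J} \<union> ({?s..?s + \<delta>} \<union> {?t - \<delta>..?t})"
  proof
    fix x assume x: "x \<in> J"
    have st: "?s \<le> x" "x \<le> ?t" using x bdd by (auto intro: cInf_lower cSup_upper)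
    show "x \<in> {y. y + \<delta> \<in> J \<and> y - \<delta> \<in> J} \<union> ({?s..?s + \<delta>} \<union> {?t - \<delta>..?t})"
    proof (cases "x \<le> ?s + \<delta> \<or> ?t - \<delta> \<le> x")
      case True
      with st show ?thesis by auto
    next
      case no: False
      obtain y where y: "y \<in> J" "y < x - \<delta>"
        using no cInf_lessD[OF False, of "x - \<delta>"] by force
      obtain z where z: "z \<in> J" "x + \<delta> < z"
        using no less_cSupD[OF False, of "x + \<delta>"] by force
      have "x - \<delta> \<in> J" "x + \<delta> \<in> J"
        using conv[OF y(1) x, of "x - \<delta>"] conv[OF x z(1), of "x + \<delta>"] y z J(3) by auto
      then show ?thesis by auto
    qed
  qed
  hence "emeasure lborel J \<le> emeasure lborel ({y. y + \<delta> \<in> J \<and> y - \<delta> \<in> J} \<union> ({?s..?s + \<delta>} \<union> {?t - \<delta>..?t}))"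
    using E by (intro emeasure_mono) auto
  also have "\<dots> \<le> emeasure lborel {y. y + \<delta> \<in> J \<and> y - \<delta> \<in> J} + emeasure lborel ({?s..?s + \<delta>} \<union> {?t - \<delta>..?t})"
    using E by (intro emeasure_subadditive) auto
  also have "emeasure lborel ({?s..?s + \<delta>} \<union> {?t - \<delta>..?t})
      \<le> emeasure lborel {?s..?s + \<delta>} + emeasure lborel {?t - \<delta>..?t}"
    by (intro emeasure_subadditive) auto
  also have "\<dots> = ennreal (2 * \<delta>)" using J(3) by (simp flip: ennreal_plus)
  finally show ?thesis by (simp add: add_left_mono)
qed auto

text \<open>Only the two end points of the segment are tested. For convex \<open>V\<close> the
  segment between them follows, and measurability is that of two preimages under shifts.\<close>

definition erode_coord :: "real \<Rightarrow> nat \<Rightarrow> (nat \<Rightarrow> real) set \<Rightarrow> (nat \<Rightarrow> real) set" where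
  "erode_coord \<delta> k V = {x. x(k := x k + \<delta>) \<in> V \<and> x(k := x k - \<delta>) \<in> V}"

lemma convex_setD:
  assumes "convex_set d V" "x \<in> V" "y \<in> V" "0 \<le> u" "0 \<le> v" "u + v = 1"
  shows "(\<lambda>i\<in>{..<d}. u * x i + v * y i) \<in> V"
  using assms by (auto simp: convex_set_def)

lemma convex_set_segment:
  assumes "convex_set d V" "V \<subseteq> eucl_space d" "k < d"
    and "x(k := a) \<in> V" "x(k := b) \<in> V" "a \<le> c" "c \<le> b"
  shows "x(k := c) \<in> V"
proof (cases "a = b")
  case False
  with assms have ab: "b - a > 0" by auto
  define u where "u = (b - c) / (b - a)"
  define v where "v = (c - a) / (b - a)"
  have uv: "0 \<le> u" "0 \<le> v" "u + v = 1"
    using assms ab by (simp_all add: u_def v_def flip: add_divide_distrib)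
  have "u * a + v * b = ((b - c) * a + (c - a) * b) / (b - a)"
    by (simp add: u_def v_def add_divide_distrib)
  also have "(b - c) * a + (c - a) * b = c * (b - a)" by (simp add: algebra_simps)
  finally have c: "u * a + v * b = c" using ab by simp
  have "(\<lambda>i\<in>{..<d}. u * (x(k := a)) i + v * (x(k := b)) i) \<in> V"
    by (rule convex_setD[OF assms(1,4,5) uv])
  also have "(\<lambda>i\<in>{..<d}. u * (x(k := a)) i + v * (x(k := b)) i) = x(k := c)"
  proof
    fix i
    have "(x(k := a)) i = undefined" if "i \<ge> d"
      using assms(2,4) that eucl_space_undefined by blast
    moreover have "u * r + v * r = r" for r
      using uv(3) by (simp flip: distrib_right)
    ultimately show "(\<lambda>i\<in>{..<d}. u * (x(k := a)) i + v * (x(k := b)) i) i = (x(k := c)) i"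
      using assms(3) c by auto
  qed
  finally show ?thesis .
next
  case True
  with assms show ?thesis by auto
qed

lemma erode_coord_subset:
  assumes "convex_set d V" "V \<subseteq> eucl_space d" "k < d" "0 \<le> \<delta>"
  shows "erode_coord \<delta> k V \<subseteq> V"
proof
  fix x assume "x \<in> erode_coord \<delta> k V"
  with convex_set_segment[OF assms(1-3), of x "x k - \<delta>" "x k + \<delta>" "x k"] assms(4)
  show "x \<in> V" by (simp add: erode_coord_def)
qed

lemma convex_set_erode_coord:
  assumes "convex_set d V" "k < d"
  shows "convex_set d (erode_coord \<delta> k V)"
  unfolding convex_set_def
proof (intro ballI allI impI)
  fix x y and u v :: real
  assume x: "x \<in> erode_coord \<delta> k V" and y: "y \<in> erode_coord \<delta> k V"
    and uv: "0 \<le> u" "0 \<le> v" "u + v = 1"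
  let ?z = "\<lambda>i\<in>{..<d}. u * x i + v * y i"
  have "?z(k := ?z k + e) = (\<lambda>i\<in>{..<d}. u * (x(k := x k + e)) i + v * (y(k := y k + e)) i)" for e
  proof -
    have "u * e + v * e = e" using uv by (simp flip: distrib_right)
    then show ?thesis using assms(2) by (auto simp: fun_eq_iff algebra_simps)
  qed
  note eq = this
  have "?z(k := ?z k + e) \<in> V" if "x(k := x k + e) \<in> V" "y(k := y k + e) \<in> V" for e
    unfolding eq using convex_setD[OF assms(1) that uv] .
  from this[of \<delta>] this[of "-\<delta>"] show "?z \<in> erode_coord \<delta> k V"
    using x y unfolding erode_coord_def by simp
qed

lemma measurable_erode_coord:
  assumes "V \<in> sets (leb d)" "k < d"
  shows "erode_coord \<delta> k V \<in> sets (leb d)"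
proof -
  have V: "V \<subseteq> eucl_space d" using sets.sets_into_space[OF assms(1)] by (simp add: space_leb)
  have m: "(\<lambda>x. x(k := x k + e)) \<in> measurable (leb d) (leb d)" for e
    by (rule measurable_fun_upd[where J = "{..<d}"]) (use assms(2) in auto)
  have "erode_coord \<delta> k V = ((\<lambda>x. x(k := x k + \<delta>)) -` V \<inter> space (leb d)) \<inter> ((\<lambda>x. x(k := x k + (-\<delta>))) -` V \<inter> space (leb d))"
    using V fun_upd_in_eucl_space_iff[OF assms(2)]
    unfolding space_leb erode_coord_def vimage_def diff_conv_add_uminus by blast
  also have "\<dots> \<in> sets (leb d)"
    by (intro sets.Int measurable_sets[OF m assms(1)])
  finally show ?thesis .
qed

text \<open>Fubini in coordinate \<open>k\<close>: the loss of at most \<open>2 * \<delta>\<close>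
  per fibre is integrated over the remaining coordinates, where only a box of volume
  \<open>(b - a) ^ (d - 1)\<close> carries nonempty fibres.\<close>

lemma emeasure_erode_coord:
  assumes V: "V \<in> sets (leb d)" "convex_set d V" "V \<subseteq> {..<d} \<rightarrow>\<^sub>E {a..b}"
    and k: "k < d" and \<delta>: "0 \<le> \<delta>" and ab: "a \<le> b"
  shows "emeasure (leb d) V \<le> emeasure (leb d) (erode_coord \<delta> k V) + ennreal (2 * \<delta> * (b - a) ^ (d - 1))"
proof -
  define I where "I = {..<d} - {k}"
  have I: "finite I" "k \<notin> I" "insert k I = {..<d}" "card I = d - 1" using k by (auto simp: I_def)
  let ?P = "\<Pi>\<^sub>M i\<in>I. lborel :: (nat \<Rightarrow> real) measure"
  let ?E = "erode_coord \<delta> k V"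
  have Veucl: "V \<subseteq> eucl_space d" using sets.sets_into_space[OF V(1)] by (simp add: space_leb)
  have E: "?E \<in> sets (leb d)" by (rule measurable_erode_coord[OF V(1) k])
  have fibre: "emeasure (leb d) A = (\<integral>\<^sup>+ x. emeasure lborel {y. x(k := y) \<in> A} \<partial>?P)"
    and fibre_sets: "x \<in> space ?P \<Longrightarrow> {y. x(k := y) \<in> A} \<in> sets borel"
    and fibre_meas: "(\<lambda>x. emeasure lborel {y. x(k := y) \<in> A}) \<in> borel_measurable ?P"
    if A: "A \<in> sets (leb d)" for A x
  proof -
    have A': "A \<in> sets (Pi\<^sub>M (insert k I) (\<lambda>_. lborel))" using A by (simp add: I)
    have sets: "{y. x(k := y) \<in> A} \<in> sets borel" if x: "x \<in> space ?P" for x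
    proof -
      have "(\<lambda>v. x(k := v)) \<in> measurable lborel (Pi\<^sub>M (insert k I) (\<lambda>_. lborel))"
        using measurable_component_update[OF x I(2)] .
      from measurable_sets[OF this A'] show ?thesis by (simp add: vimage_def)
    qed
    then show "x \<in> space ?P \<Longrightarrow> {y. x(k := y) \<in> A} \<in> sets borel" .
    have inner: "(\<integral>\<^sup>+ y. indicator A (x(k := y)) \<partial>lborel) = emeasure lborel {y. x(k := y) \<in> A}"
      if x: "x \<in> space ?P" for x
    proof -
      have "(\<integral>\<^sup>+ y. indicator A (x(k := y)) \<partial>lborel) = (\<integral>\<^sup>+ y. indicator {y. x(k := y) \<in> A} y \<partial>lborel)"
        by (intro nn_integral_cong) (auto simp: indicator_def)
      then show ?thesis using sets[OF x] by simp
    qed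
    have "emeasure (leb d) A = (\<integral>\<^sup>+ x. indicator A x \<partial>Pi\<^sub>M (insert k I) (\<lambda>_. lborel))"
      using A by (simp add: I)
    also have "\<dots> = (\<integral>\<^sup>+ x. (\<integral>\<^sup>+ y. indicator A (x(k := y)) \<partial>lborel) \<partial>?P)"
      using A' I by (intro lborel_prod.product_nn_integral_insert) auto
    also have "\<dots> = (\<integral>\<^sup>+ x. emeasure lborel {y. x(k := y) \<in> A} \<partial>?P)"
      by (intro nn_integral_cong inner)
    finally show "emeasure (leb d) A = \<dots>" .
    have "(\<lambda>x. \<integral>\<^sup>+ y. indicator A (x(k := y)) \<partial>lborel) \<in> borel_measurable ?P"
    proof (rule lborel.borel_measurable_nn_integral)
      have "(\<lambda>(x, y). x(k := y)) \<in> measurable (?P \<Otimes>\<^sub>M lborel) (Pi\<^sub>M (insert k I) (\<lambda>_. lborel))"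
        by (rule measurable_add_dim)
      from measurable_compose[OF this borel_measurable_indicator[OF A']]
      show "(\<lambda>(x, y). indicator A (x(k := y))) \<in> borel_measurable (?P \<Otimes>\<^sub>M lborel)"
        by (simp add: case_prod_beta')
    qed
    then show "(\<lambda>x. emeasure lborel {y. x(k := y) \<in> A}) \<in> borel_measurable ?P"
      by (subst measurable_cong[OF inner[symmetric]])
  qed
  have pointwise: "emeasure lborel {y. x(k := y) \<in> V}
      \<le> emeasure lborel {y. x(k := y) \<in> ?E} + ennreal (2 * \<delta>) * indicator (I \<rightarrow>\<^sub>E {a..b}) x"
    if x: "x \<in> space ?P" for x
  proof (cases "x \<in> I \<rightarrow>\<^sub>E {a..b}")
    case True
    have "emeasure lborel {y. x(k := y) \<in> V}
        \<le> emeasure lborel {y. y + \<delta> \<in> {y. x(k := y) \<in> V} \<and> y - \<delta> \<in> {y. x(k := y) \<in> V}} + ennreal (2 * \<delta>)"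
    proof (rule interval_erosion_1d)
      show "{y. x(k := y) \<in> V} \<subseteq> {a..b}" 
      proof
        fix y assume "y \<in> {y. x(k := y) \<in> V}"
        hence "x(k := y) \<in> {..<d} \<rightarrow>\<^sub>E {a..b}" using V(3) by auto
        from PiE_mem[OF this, of k] k show "y \<in> {a..b}" by simp
      qed
      show "z \<in> {y. x(k := y) \<in> V}"
        if "y \<in> {y. x(k := y) \<in> V}" "y' \<in> {y. x(k := y) \<in> V}" "y \<le> z" "z \<le> y'" for y y' z
        using convex_set_segment[OF V(2) Veucl k, of x y y' z] that by auto
    qed (use fibre_sets[OF V(1) x] \<delta> in auto)
    with True show ?thesis by (simp add: erode_coord_def)
  next
    case False
    have "x(k := y) \<notin> V" for y
    proof
      assume "x(k := y) \<in> V"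
      hence y: "x(k := y) \<in> {..<d} \<rightarrow>\<^sub>E {a..b}" using V(3) by auto
      have "x i \<in> {a..b}" if "i \<in> I" for i
        using PiE_mem[OF y, of i] that by (auto simp: I_def)
      with x have "x \<in> I \<rightarrow>\<^sub>E {a..b}" by (auto simp: space_PiM PiE_iff)
      with False show False by simp
    qed
    then show ?thesis by simp
  qed
  have "emeasure (leb d) V = (\<integral>\<^sup>+ x. emeasure lborel {y. x(k := y) \<in> V} \<partial>?P)"
    by (rule fibre[OF V(1)])
  also have "\<dots> \<le> (\<integral>\<^sup>+ x. emeasure lborel {y. x(k := y) \<in> ?E} + ennreal (2 * \<delta>) * indicator (I \<rightarrow>\<^sub>E {a..b}) x \<partial>?P)"
    by (intro nn_integral_mono pointwise)
  also have "\<dots> = emeasure (leb d) ?E + ennreal (2 * \<delta>) * emeasure ?P (I \<rightarrow>\<^sub>E {a..b})"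
    using fibre_meas[OF E] I by (simp add: nn_integral_add nn_integral_cmult_indicator fibre[OF E])
  also have "ennreal (2 * \<delta>) * emeasure ?P (I \<rightarrow>\<^sub>E {a..b}) = ennreal (2 * \<delta> * (b - a) ^ (d - 1))"
    using emeasure_box[OF I(1) ab] I(4) \<delta> ab by (simp add: ennreal_mult)
  finally show ?thesis .
qed

text \<open>After \<open>d\<close> rounds membership says that all corners of the cube of radius
  \<open>\<delta>\<close> around the point lie in \<open>V\<close>; for convex \<open>V\<close> this
  is erosion by the whole cube. One coordinate per round keeps the loss accessible to
  Fubini.\<close>

primrec erode :: "real \<Rightarrow> (nat \<Rightarrow> real) set \<Rightarrow> nat \<Rightarrow> (nat \<Rightarrow> real) set" where
  "erode \<delta> V 0 = V"
| "erode \<delta> V (Suc k) = erode_coord \<delta> k (erode \<delta> V k)"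

lemma erode_basic:
  assumes "convex_set d V" "V \<in> sets (leb d)" "0 \<le> \<delta>" "k \<le> d"
  shows "convex_set d (erode \<delta> V k) \<and> erode \<delta> V k \<in> sets (leb d) \<and> erode \<delta> V k \<subseteq> V"
  using assms(4)
proof (induction k)
  case (Suc k)
  hence IH: "convex_set d (erode \<delta> V k)" "erode \<delta> V k \<in> sets (leb d)" "erode \<delta> V k \<subseteq> V"
    and k: "k < d" by auto
  have "erode \<delta> V k \<subseteq> eucl_space d"
    using sets.sets_into_space[OF IH(2)] by (simp add: space_leb)
  with IH k assms(3) show ?case
    using erode_coord_subset[of d "erode \<delta> V k" k \<delta>]
    by (auto simp: convex_set_erode_coord measurable_erode_coord)
qed (use assms in auto)

lemma emeasure_erode:
  assumes V: "convex_set d V" "V \<in> sets (leb d)" "V \<subseteq> {..<d} \<rightarrow>\<^sub>E {a..b}"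
    and \<delta>: "0 \<le> \<delta>" and ab: "a \<le> b" and k: "k \<le> d"
  shows "emeasure (leb d) V \<le> emeasure (leb d) (erode \<delta> V k) + ennreal (real k * (2 * \<delta> * (b - a) ^ (d - 1)))"
  using k
proof (induction k)
  case (Suc k)
  let ?c = "2 * \<delta> * (b - a) ^ (d - 1)"
  have c: "0 \<le> ?c" using \<delta> ab by simp
  have E: "convex_set d (erode \<delta> V k)" "erode \<delta> V k \<in> sets (leb d)" "erode \<delta> V k \<subseteq> V"
    using erode_basic[OF V(1,2) \<delta>, of k] Suc.prems by auto
  have "emeasure (leb d) V \<le> emeasure (leb d) (erode \<delta> V k) + ennreal (real k * ?c)"
    using Suc by simp
  also have "emeasure (leb d) (erode \<delta> V k) \<le> emeasure (leb d) (erode \<delta> V (Suc k)) + ennreal ?c"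
    using emeasure_erode_coord[OF E(2,1) _ _ \<delta> ab, of k] E(3) V(3) Suc.prems by auto
  finally have "emeasure (leb d) V \<le> emeasure (leb d) (erode \<delta> V (Suc k)) + (ennreal ?c + ennreal (real k * ?c))"
    by (simp add: add.assoc add_right_mono)
  also have "ennreal ?c + ennreal (real k * ?c) = ennreal (real (Suc k) * ?c)"
    using ennreal_plus[OF c, of "real k * ?c"] c by (simp only: of_nat_Suc distrib_right mult_1 mult_nonneg_nonneg of_nat_0_le_iff)
  finally show ?case .
qed simp

text \<open>Coordinates are released from the last one down: a move by at most
  \<open>\<delta>\<close> in coordinate \<open>k\<close> stays on the segment between the two points
  tested by \<open>erode_coord\<close>, hence in the previous erosion.\<close>

lemma erode_translate:
  assumes V: "convex_set d V" "V \<in> sets (leb d)" and \<delta>: "0 \<le> \<delta>" and k: "k \<le> d"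
    and x: "x \<in> erode \<delta> V k" and t: "\<And>i. i < k \<Longrightarrow> \<bar>t i\<bar> \<le> \<delta>"
  shows "(\<lambda>i\<in>{..<d}. x i + (if i < k then t i else 0)) \<in> V"
  using k x t
proof (induction k arbitrary: x)
  case 0
  have "V \<subseteq> eucl_space d" using sets.sets_into_space[OF V(2)] by (simp add: space_leb)
  with 0 have "(\<lambda>i\<in>{..<d}. x i) = x" by (auto simp: eucl_space_def)
  with 0 show ?case by simp
next
  case (Suc k)
  have E: "convex_set d (erode \<delta> V k)" "erode \<delta> V k \<in> sets (leb d)"
    using erode_basic[OF V(1,2) \<delta>, of k] Suc.prems by auto
  have Es: "erode \<delta> V k \<subseteq> eucl_space d"
    using sets.sets_into_space[OF E(2)] by (simp add: space_leb)
  define x' where "x' = x(k := x k + t k)"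
  have "x' \<in> erode \<delta> V k"
    unfolding x'_def
    by (rule convex_set_segment[OF E(1) Es, where a = "x k - \<delta>" and b = "x k + \<delta>"])
       (use Suc.prems(1,2) Suc.prems(3)[of k] in \<open>auto simp: erode_coord_def\<close>)
  have "(\<lambda>i\<in>{..<d}. x' i + (if i < k then t i else 0)) \<in> V"
    using Suc.prems by (intro Suc.IH \<open>x' \<in> erode \<delta> V k\<close>) auto
  also have "(\<lambda>i\<in>{..<d}. x' i + (if i < k then t i else 0)) = (\<lambda>i\<in>{..<d}. x i + (if i < Suc k then t i else 0))"
    by (auto simp: x'_def fun_eq_iff less_Suc_eq)
  finally show ?case .
qed

text \<open>
  This replaces the topology of convex sets (interior, closure): it shows that eroding the
  \<open>\<eta>\<close>-neighbourhood of a convex set \<open>C\<close> by cubes of radius \<open>\<eta>\<close> leads back into \<open>C\<close>.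
\<close>
lemma convex_set_surrounded:
  assumes C: "convex_set d C" "C \<subseteq> eucl_space d" and x: "x \<in> eucl_space d"
    and sur: "\<And>s :: nat \<Rightarrow> bool. \<exists>c\<in>C. \<forall>i<d. if s i then x i < c i else c i < x i"
  shows "x \<in> C"
proof -
  \<comment> \<open>The induction fixes coordinates one at a time: the first \<open>k\<close> agree
    with \<open>x\<close>, and the others can still be placed on any prescribed sides. All sign
    patterns are needed because each step combines two of them.\<close>
  have "\<exists>c\<in>C. (\<forall>i<k. c i = x i) \<and> (\<forall>i<d. k \<le> i \<longrightarrow> (if s i then x i < c i else c i < x i))"
    if "k \<le> d" for k s
    using that
  proof (induction k arbitrary: s)
    case 0
    then show ?case using sur[of s] by auto
  next
    case (Suc k)
    obtain p where p: "p \<in> C" "\<And>i. i < k \<Longrightarrow> p i = x i"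
      "\<And>i. i < d \<Longrightarrow> k \<le> i \<Longrightarrow> (if (s(k := True)) i then x i < p i else p i < x i)"
      using Suc.IH[of "s(k := True)"] Suc.prems by auto
    obtain q where q: "q \<in> C" "\<And>i. i < k \<Longrightarrow> q i = x i"
      "\<And>i. i < d \<Longrightarrow> k \<le> i \<Longrightarrow> (if (s(k := False)) i then x i < q i else q i < x i)"
      using Suc.IH[of "s(k := False)"] Suc.prems by auto
    have k: "q k < x k" "x k < p k" using p(3)[of k] q(3)[of k] Suc.prems by auto
    \<comment> \<open>The weights make coordinate \<open>k\<close> hit \<open>x k\<close>. The
      points \<open>p\<close> and \<open>q\<close> share the sign pattern beyond \<open>k\<close>,
      so the strict inequalities there survive the combination.\<close>
    define u where "u = (x k - q k) / (p k - q k)"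
    define v where "v = (p k - x k) / (p k - q k)"
    have uv: "u > 0" "v > 0" "u + v = 1" "u * p k + v * q k = x k"
      using k unfolding u_def v_def by (auto simp: divide_simps) (auto simp: algebra_simps)
    let ?c = "\<lambda>i\<in>{..<d}. u * p i + v * q i"
    have "?c \<in> C" using C(1) p(1) q(1) uv by (intro convex_setD) auto
    moreover have "?c i = x i" if "i < Suc k" for i
    proof (cases "i = k")
      case False
      with that p(2) q(2) Suc.prems have "?c i = (u + v) * x i" by (simp add: distrib_right)
      with uv show ?thesis by simp
    qed (use uv Suc.prems in simp)
    moreover have "if s i then x i < ?c i else ?c i < x i" if i: "i < d" "Suc k \<le> i" for i
    proof -
      have xi: "x i = u * x i + v * x i" using uv(3) by (simp flip: distrib_right)
      show ?thesis
      proof (cases "s i")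
        case True
        hence "u * x i < u * p i" "v * x i < v * q i"
          using p(3)[of i] q(3)[of i] i uv by (auto split: if_splits)
        with xi True i show ?thesis by simp
      next
        case False
        hence "u * p i < u * x i" "v * q i < v * x i"
          using p(3)[of i] q(3)[of i] i uv by (auto split: if_splits)
        with xi False i show ?thesis by simp
      qed
    qed
    ultimately show ?case by blast
  qed
  from this[of d undefined] obtain c where c: "c \<in> C" "\<forall>i<d. c i = x i" by auto
  hence "c = x" using C(2) x unfolding eucl_space_def by (intro PiE_ext[of c _ _ x]) auto
  with c show ?thesis by simp
qed

section \<open>Open neighbourhoods in the sup norm\<close>

definition dilate :: "nat \<Rightarrow> real \<Rightarrow> (nat \<Rightarrow> real) set \<Rightarrow> (nat \<Rightarrow> real) set" where
  "dilate d \<eta> C = {x \<in> eucl_space d. \<exists>c\<in>C. \<forall>i<d. \<bar>x i - c i\<bar> < \<eta>}"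

text \<open>Strictness in \<open>dilate\<close> makes the set open whatever \<open>C\<close> is:
  each of its points lies in a box with rational corners inside it, and there are countably many
  such boxes.\<close>

lemma sets_dilate: "dilate d \<eta> C \<in> sets (leb d)"
proof -
  let ?Q = "{..<d} \<rightarrow>\<^sub>E \<rat>"
  define T where "T = {(l, r) \<in> ?Q \<times> ?Q. (\<Pi>\<^sub>E i\<in>{..<d}. {l i<..<r i}) \<subseteq> dilate d \<eta> C}"
  have "countable T"
  proof (rule countable_subset)
    show "countable (?Q \<times> ?Q :: ((nat \<Rightarrow> real) \<times> (nat \<Rightarrow> real)) set)"
      by (intro countable_SIGMA countable_PiE countable_rat) auto
  qed (auto simp: T_def)
  moreover have "(\<Pi>\<^sub>E i\<in>{..<d}. {l i<..<r i}) \<in> sets (leb d)" for l r :: "nat \<Rightarrow> real"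
    by (intro sets_PiM_I_finite) auto
  moreover have "dilate d \<eta> C = (\<Union>(l, r)\<in>T. \<Pi>\<^sub>E i\<in>{..<d}. {l i<..<r i})"
  proof (intro equalityI subsetI)
    fix x assume x: "x \<in> dilate d \<eta> C"
    then obtain c where c: "c \<in> C" "\<And>i. i < d \<Longrightarrow> \<bar>x i - c i\<bar> < \<eta>" and xe: "x \<in> eucl_space d"
      by (auto simp: dilate_def)
    have "\<exists>l\<in>\<rat>. \<exists>r\<in>\<rat>. i < d \<longrightarrow> c i - \<eta> < l \<and> l < x i \<and> x i < r \<and> r < c i + \<eta>" for i
    proof (cases "i < d")
      case True
      with c(2)[of i] have "c i - \<eta> < x i" "x i < c i + \<eta>" by auto
      from Rats_dense_in_real[OF this(1)] Rats_dense_in_real[OF this(2)] show ?thesis by auto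
    qed (auto intro: Rats_0)
    then obtain l r where lr: "\<And>i. l i \<in> \<rat>" "\<And>i. r i \<in> \<rat>"
      "\<And>i. i < d \<Longrightarrow> c i - \<eta> < l i \<and> l i < x i \<and> x i < r i \<and> r i < c i + \<eta>"
      by metis
    let ?l = "restrict l {..<d}" and ?r = "restrict r {..<d}"
    have "(\<Pi>\<^sub>E i\<in>{..<d}. {?l i<..<?r i}) \<subseteq> dilate d \<eta> C"
    proof
      fix y assume y: "y \<in> (\<Pi>\<^sub>E i\<in>{..<d}. {?l i<..<?r i})"
      have "\<bar>y i - c i\<bar> < \<eta>" if "i < d" for i
        using PiE_mem[OF y, of i] lr(3)[of i] that by auto
      with y c(1) show "y \<in> dilate d \<eta> C"
        by (auto simp: dilate_def eucl_space_def)
    qed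
    hence "(?l, ?r) \<in> T" using lr by (auto simp: T_def)
    moreover have "x \<in> (\<Pi>\<^sub>E i\<in>{..<d}. {?l i<..<?r i})"
      using xe lr by (auto simp: eucl_space_def PiE_iff)
    ultimately show "x \<in> (\<Union>(l, r)\<in>T. \<Pi>\<^sub>E i\<in>{..<d}. {l i<..<r i})" by blast
  qed (auto simp: T_def)
  ultimately show ?thesis by (auto intro!: sets.countable_UN'')
qed

lemma convex_set_dilate:
  assumes "convex_set d C"
  shows "convex_set d (dilate d \<eta> C)"
  unfolding convex_set_def
proof (intro ballI allI impI)
  fix x y and u v :: real
  assume "x \<in> dilate d \<eta> C" "y \<in> dilate d \<eta> C" and uv: "0 \<le> u" "0 \<le> v" "u + v = 1"
  then obtain p q where p: "p \<in> C" "\<And>i. i < d \<Longrightarrow> \<bar>x i - p i\<bar> < \<eta>"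
    and q: "q \<in> C" "\<And>i. i < d \<Longrightarrow> \<bar>y i - q i\<bar> < \<eta>" by (auto simp: dilate_def)
  have "\<bar>(u * x i + v * y i) - (u * p i + v * q i)\<bar> < \<eta>" if i: "i < d" for i
  proof -
    have "(u * x i + v * y i) - (u * p i + v * q i) = u * (x i - p i) + v * (y i - q i)"
      by (simp add: algebra_simps)
    also have "\<bar>\<dots>\<bar> \<le> u * \<bar>x i - p i\<bar> + v * \<bar>y i - q i\<bar>"
      using uv by (metis abs_mult abs_of_nonneg abs_triangle_ineq)
    also have "\<dots> < \<eta>"
      using uv p(2)[OF i] q(2)[OF i] by (intro convex_bound_lt) auto
    finally show ?thesis .
  qed
  moreover have "(\<lambda>i\<in>{..<d}. u * p i + v * q i) \<in> C"
    using assms p q uv by (intro convex_setD) auto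
  ultimately show "(\<lambda>i\<in>{..<d}. u * x i + v * y i) \<in> dilate d \<eta> C"
    by (auto simp: dilate_def eucl_space_def intro!: bexI[of _ "\<lambda>i\<in>{..<d}. u * p i + v * q i"])
qed

lemma subset_dilate: "C \<subseteq> eucl_space d \<Longrightarrow> 0 < \<eta> \<Longrightarrow> C \<subseteq> dilate d \<eta> C"
  by (auto simp: dilate_def intro!: bexI)

lemma dilate_unit_cube_subset:
  assumes "C \<subseteq> unit_cube d"
  shows "dilate d \<eta> C \<subseteq> {..<d} \<rightarrow>\<^sub>E {-\<eta>..1 + \<eta>}"
proof
  fix x assume "x \<in> dilate d \<eta> C"
  then obtain c where c: "c \<in> C" "\<And>i. i < d \<Longrightarrow> \<bar>x i - c i\<bar> < \<eta>" and x: "x \<in> eucl_space d"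
    by (auto simp: dilate_def)
  have "x i \<in> {-\<eta>..1 + \<eta>}" if "i < d" for i
  proof -
    have "c i \<in> {0..<1}" using c(1) assms that unfolding unit_cube_def by (blast dest: PiE_mem)
    with c(2)[OF that] show ?thesis by auto
  qed
  with x show "x \<in> {..<d} \<rightarrow>\<^sub>E {-\<eta>..1 + \<eta>}" by (auto simp: eucl_space_def PiE_iff)
qed

text \<open>Every shift of \<open>x + t\<close> by a corner of the cube of radius
  \<open>\<eta>\<close> lies in the neighbourhood. A point of \<open>C\<close> strictly within
  \<open>\<eta>\<close> of that corner is on the corner's side of \<open>x + t\<close> in each
  coordinate, so \<open>C\<close> surrounds \<open>x + t\<close>.\<close>

lemma erode_dilate_subset:
  assumes C: "convex_set d C" "C \<subseteq> eucl_space d" and \<eta>: "0 \<le> \<eta>" "0 \<le> \<epsilon>"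
    and x: "x \<in> erode (\<eta> + \<epsilon>) (dilate d \<eta> C) d" and t: "\<And>i. i < d \<Longrightarrow> \<bar>t i\<bar> \<le> \<epsilon>"
  shows "(\<lambda>i\<in>{..<d}. x i + t i) \<in> C"
proof (rule convex_set_surrounded[OF C])
  fix s :: "nat \<Rightarrow> bool"
  have "(\<lambda>i\<in>{..<d}. x i + (if i < d then t i + (if s i then \<eta> else - \<eta>) else 0)) \<in> dilate d \<eta> C"
    by (rule erode_translate[OF convex_set_dilate[OF C(1)] sets_dilate _ _ x]) (use \<eta> t in force)+
  then obtain c where c: "c \<in> C" "\<And>i. i < d \<Longrightarrow> \<bar>x i + (t i + (if s i then \<eta> else - \<eta>)) - c i\<bar> < \<eta>"
    by (auto simp: dilate_def)
  have "if s i then (\<lambda>i\<in>{..<d}. x i + t i) i < c i else c i < (\<lambda>i\<in>{..<d}. x i + t i) i" if "i < d" for i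
    using c(2)[OF that] that by (auto split: if_splits)
  with c(1) show "\<exists>c\<in>C. \<forall>i<d. if s i then (\<lambda>i\<in>{..<d}. x i + t i) i < c i else c i < (\<lambda>i\<in>{..<d}. x i + t i) i"
    by blast
qed (simp add: eucl_space_def)

section \<open>Counting lattice points\<close>

definition vadd :: "nat \<Rightarrow> (nat \<Rightarrow> real) \<Rightarrow> (nat \<Rightarrow> real) \<Rightarrow> nat \<Rightarrow> real" where
  "vadd d x y = (\<lambda>i\<in>{..<d}. x i + y i)"

lemma vadd_in_eucl_space [simp]: "vadd d x y \<in> eucl_space d"
  by (simp add: vadd_def)

lemma vadd_apply: "i < d \<Longrightarrow> vadd d x y i = x i + y i"
  by (simp add: vadd_def)

lemma vadd_assoc: "vadd d (vadd d x y) z = vadd d x (vadd d y z)"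
  by (auto simp: vadd_def add.assoc)

lemma vadd_commute: "vadd d x y = vadd d y x"
  by (auto simp: vadd_def add.commute)

lemma measurable_vadd: "(\<lambda>x. vadd d x a) \<in> measurable (leb d) (leb d)"
  unfolding vadd_def by measurable

lemma emeasure_lborel_shift:
  fixes S :: "real set"
  assumes "S \<in> sets borel"
  shows "emeasure lborel {y. y + a \<in> S} = emeasure lborel S"
proof -
  have "emeasure lborel S = emeasure (distr lborel borel ((+) a)) S"
    by (simp only: lborel_distr_plus)
  also have "\<dots> = emeasure lborel {y. y + a \<in> S}"
    using assms by (subst emeasure_distr) (auto simp: vimage_def add.commute)
  finally show ?thesis ..
qed

lemma distr_vadd: "distr (leb d) (leb d) (\<lambda>x. vadd d x a) = leb d"
proof (rule lborel_prod.PiM_eqI)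
  fix A :: "nat \<Rightarrow> real set" assume A: "\<And>i. i \<in> {..<d} \<Longrightarrow> A i \<in> sets lborel"
  have "emeasure (distr (leb d) (leb d) (\<lambda>x. vadd d x a)) (Pi\<^sub>E {..<d} A)
      = emeasure (leb d) ((\<lambda>x. vadd d x a) -` Pi\<^sub>E {..<d} A \<inter> space (leb d))"
    by (rule emeasure_distr[OF measurable_vadd]) (rule sets_PiM_I_finite[OF finite_lessThan A])
  also have "(\<lambda>x. vadd d x a) -` Pi\<^sub>E {..<d} A \<inter> space (leb d) = (\<Pi>\<^sub>E i\<in>{..<d}. {y. y + a i \<in> A i})"
  proof (rule set_eqI)
    fix x
    have "vadd d x a \<in> Pi\<^sub>E {..<d} A \<longleftrightarrow> (\<forall>i\<in>{..<d}. x i + a i \<in> A i)"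
      by (simp add: vadd_def PiE_iff)
    then show "x \<in> (\<lambda>x. vadd d x a) -` Pi\<^sub>E {..<d} A \<inter> space (leb d)
        \<longleftrightarrow> x \<in> (\<Pi>\<^sub>E i\<in>{..<d}. {y. y + a i \<in> A i})"
      by (simp add: space_leb eucl_space_def PiE_iff)
  qed
  also have "emeasure (leb d) \<dots> = (\<Prod>i<d. emeasure lborel {y. y + a i \<in> A i})"
  proof (rule lborel_prod.emeasure_PiM)
    fix i assume "i \<in> {..<d}"
    from A[OF this] have [measurable]: "A i \<in> sets borel" by simp
    show "{y. y + a i \<in> A i} \<in> sets lborel" by measurable
  qed simp
  also have "\<dots> = (\<Prod>i<d. emeasure lborel (A i))"
    using A by (intro prod.cong refl emeasure_lborel_shift) simp
  finally show "emeasure (distr (leb d) (leb d) (\<lambda>x. vadd d x a)) (Pi\<^sub>E {..<d} A) = (\<Prod>i\<in>{..<d}. emeasure lborel (A i))" .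
qed simp_all

lemma nn_integral_vadd:
  assumes "f \<in> borel_measurable (leb d)"
  shows "(\<integral>\<^sup>+ x. f (vadd d x a) \<partial>leb d) = (\<integral>\<^sup>+ x. f x \<partial>leb d)"
proof -
  have "(\<integral>\<^sup>+ x. f (vadd d x a) \<partial>leb d) = (\<integral>\<^sup>+ x. f x \<partial>distr (leb d) (leb d) (\<lambda>x. vadd d x a))"
    using assms by (intro nn_integral_distr[symmetric] measurable_vadd) simp
  then show ?thesis by (simp only: distr_vadd)
qed

lemma lattice_vadd: "is_lattice d L \<Longrightarrow> x \<in> L \<Longrightarrow> y \<in> L \<Longrightarrow> vadd d x y \<in> L"
  unfolding vadd_def by (rule lattice_add_closed)

lemma lattice_vdiff: "is_lattice d L \<Longrightarrow> x \<in> L \<Longrightarrow> y \<in> L \<Longrightarrow> vadd d x (\<lambda>i. - y i) \<in> L"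
  using lattice_diff_closed[of d L x y] by (simp add: vadd_def)

section \<open>The unit cube as a fundamental domain of the integer vectors\<close>

abbreviation int_vectors :: "nat \<Rightarrow> (nat \<Rightarrow> real) set" where
  "int_vectors d \<equiv> {..<d} \<rightarrow>\<^sub>E \<int>"

lemma sets_unit_cube [measurable]: "unit_cube d \<in> sets (leb d)"
  unfolding unit_cube_def by (intro sets_PiM_I_finite) auto

lemma emeasure_unit_cube: "emeasure (leb d) (unit_cube d) = 1"
proof -
  have "emeasure (leb d) (unit_cube d) = (\<Prod>i<d. emeasure lborel {0..<1::real})"
    unfolding unit_cube_def by (intro lborel_prod.emeasure_PiM) auto
  then show ?thesis by simp
qed

lemma unit_cube_subset: "unit_cube d \<subseteq> eucl_space d"
  by (auto simp: unit_cube_def eucl_space_def PiE_iff)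

definition vfloor :: "nat \<Rightarrow> (nat \<Rightarrow> real) \<Rightarrow> nat \<Rightarrow> real" where
  "vfloor d x = (\<lambda>i\<in>{..<d}. of_int \<lfloor>x i\<rfloor>)"

lemma vfloor_int_vectors: "vfloor d x \<in> int_vectors d"
  by (auto simp: vfloor_def)

text \<open>The half-open cube is met by exactly one integer translate of each point; this one fact
  gives both the tiling of space and the unique splitting of lattice vectors.\<close>

lemma diff_in_unit_cube_iff:
  assumes "z \<in> int_vectors d"
  shows "vadd d x (\<lambda>i. - z i) \<in> unit_cube d \<longleftrightarrow> z = vfloor d x"
proof
  assume c: "vadd d x (\<lambda>i. - z i) \<in> unit_cube d"
  show "z = vfloor d x"
  proof (rule PiE_ext[OF assms vfloor_int_vectors])
    fix i assume i: "i \<in> {..<d}"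
    then obtain k :: int where k: "z i = of_int k"
      using PiE_mem[OF assms i] by (auto elim: Ints_cases)
    have "x i - z i \<in> {0..<1}" using PiE_mem[OF c[unfolded unit_cube_def] i] i
      by (simp add: vadd_apply)
    hence "\<lfloor>x i\<rfloor> = k" unfolding k by (intro floor_unique) auto
    then show "z i = vfloor d x i" using i k by (simp add: vfloor_def)
  qed
next
  assume z: "z = vfloor d x"
  have "0 \<le> x i - of_int \<lfloor>x i\<rfloor>" "x i - of_int \<lfloor>x i\<rfloor> < 1" for i
    by linarith+
  then show "vadd d x (\<lambda>i. - z i) \<in> unit_cube d"
    by (auto simp: z vadd_def unit_cube_def vfloor_def)
qed

lemma countable_int_vectors: "countable (int_vectors d)"
  by (intro countable_PiE) (auto simp: Ints_def)

text \<open>Multiply \<open>f\<close> by the partition of unity formed by the integer translates of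
  the cube indicator, exchange the sum with the integral, and translate each term back to the
  cube.\<close>

lemma nn_integral_tile:
  assumes f: "f \<in> borel_measurable (leb d)"
  shows "(\<integral>\<^sup>+ x. f x \<partial>leb d)
     = (\<integral>\<^sup>+ x. (\<integral>\<^sup>+ z. f (vadd d x z) \<partial>count_space (int_vectors d)) * indicator (unit_cube d) x \<partial>leb d)"
proof -
  let ?Z = "int_vectors d" and ?c = "indicator (unit_cube d) :: (nat \<Rightarrow> real) \<Rightarrow> ennreal"
  note [measurable] = f
  have [measurable]: "(\<lambda>x. f (vadd d x z)) \<in> borel_measurable (leb d)" for z
    using measurable_compose[OF measurable_vadd f] .
  have [measurable]: "(\<lambda>x. ?c (vadd d x z)) \<in> borel_measurable (leb d)" for z
    by (rule measurable_compose[OF measurable_vadd]) measurable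
  have one: "(\<integral>\<^sup>+ z. ?c (vadd d x (\<lambda>i. - z i)) \<partial>count_space ?Z) = 1" for x
  proof -
    have "(\<integral>\<^sup>+ z. ?c (vadd d x (\<lambda>i. - z i)) \<partial>count_space ?Z) = (\<integral>\<^sup>+ z. indicator {vfloor d x} z \<partial>count_space ?Z)"
      by (intro nn_integral_cong) (auto simp: indicator_def diff_in_unit_cube_iff)
    also have "\<dots> = emeasure (count_space ?Z) {vfloor d x}"
      using vfloor_int_vectors by (intro nn_integral_indicator) auto
    also have "\<dots> = 1"
      using vfloor_int_vectors by (subst emeasure_count_space_finite) auto
    finally show ?thesis .
  qed
  have "(\<integral>\<^sup>+ x. f x \<partial>leb d) = (\<integral>\<^sup>+ x. f x * (\<integral>\<^sup>+ z. ?c (vadd d x (\<lambda>i. - z i)) \<partial>count_space ?Z) \<partial>leb d)"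
    by (simp add: one)
  also have "\<dots> = (\<integral>\<^sup>+ x. (\<integral>\<^sup>+ z. f x * ?c (vadd d x (\<lambda>i. - z i)) \<partial>count_space ?Z) \<partial>leb d)"
    by (intro nn_integral_cong nn_integral_cmult[symmetric]) auto
  also have "\<dots> = (\<integral>\<^sup>+ z. (\<integral>\<^sup>+ x. f x * ?c (vadd d x (\<lambda>i. - z i)) \<partial>leb d) \<partial>count_space ?Z)"
    by (rule nn_integral_count_space_nn_integral[OF countable_int_vectors]) measurable
  also have "\<dots> = (\<integral>\<^sup>+ z. (\<integral>\<^sup>+ x. f (vadd d x z) * ?c x \<partial>leb d) \<partial>count_space ?Z)"
  proof (rule nn_integral_cong)
    fix z
    have "(\<integral>\<^sup>+ x. f x * ?c (vadd d x (\<lambda>i. - z i)) \<partial>leb d)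
        = (\<integral>\<^sup>+ x. f (vadd d x z) * ?c (vadd d (vadd d x z) (\<lambda>i. - z i)) \<partial>leb d)"
      by (rule nn_integral_vadd[symmetric]) measurable
    also have "\<dots> = (\<integral>\<^sup>+ x. f (vadd d x z) * ?c x \<partial>leb d)"
    proof (intro nn_integral_cong)
      fix x assume "x \<in> space (leb d)"
      hence "vadd d (vadd d x z) (\<lambda>i. - z i) = x"
        unfolding space_leb by (intro eucl_space_eqI[of _ d]) (auto simp: vadd_apply)
      then show "f (vadd d x z) * ?c (vadd d (vadd d x z) (\<lambda>i. - z i)) = f (vadd d x z) * ?c x" by simp
    qed
    finally show "(\<integral>\<^sup>+ x. f x * ?c (vadd d x (\<lambda>i. - z i)) \<partial>leb d) = (\<integral>\<^sup>+ x. f (vadd d x z) * ?c x \<partial>leb d)" .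
  qed
  also have "\<dots> = (\<integral>\<^sup>+ x. (\<integral>\<^sup>+ z. f (vadd d x z) * ?c x \<partial>count_space ?Z) \<partial>leb d)"
    by (rule nn_integral_count_space_nn_integral[OF countable_int_vectors, symmetric]) measurable
  also have "\<dots> = (\<integral>\<^sup>+ x. (\<integral>\<^sup>+ z. f (vadd d x z) \<partial>count_space ?Z) * ?c x \<partial>leb d)"
    by (intro nn_integral_cong nn_integral_multc) auto
  finally show ?thesis .
qed

text \<open>Each \<open>p\<close> contributes the measure of \<open>A\<close> by translation
  invariance, and tiling folds the integral into the cube. When \<open>P\<close> consists of the
  lattice points of the cube, the pairs stand for the vectors of \<open>L\<close>; counting them
  with \<open>emeasure\<close> leaves room for infinite counts.\<close>

lemma emeasure_unfold:
  assumes P: "finite P" and A: "A \<in> sets (leb d)"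
  shows "of_nat (card P) * emeasure (leb d) A
    = (\<integral>\<^sup>+ x. emeasure (count_space UNIV) {(p, z). p \<in> P \<and> z \<in> int_vectors d \<and> vadd d x (vadd d p z) \<in> A}
          * indicator (unit_cube d) x \<partial>leb d)"
proof -
  let ?Z = "int_vectors d"
  note [measurable] = A
  have m: "(\<lambda>x. indicator A (vadd d x p) :: ennreal) \<in> borel_measurable (leb d)" for p
    by (rule measurable_compose[OF measurable_vadd]) measurable
  have "of_nat (card P) * emeasure (leb d) A = (\<Sum>p\<in>P. emeasure (leb d) A)" by simp
  also have "\<dots> = (\<Sum>p\<in>P. \<integral>\<^sup>+ x. indicator A (vadd d x p) \<partial>leb d)"
    using A by (intro sum.cong refl) (subst nn_integral_vadd, auto)
  also have "\<dots> = (\<integral>\<^sup>+ x. (\<Sum>p\<in>P. indicator A (vadd d x p)) \<partial>leb d)"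
    using m by (intro nn_integral_sum[symmetric])
  also have "\<dots> = (\<integral>\<^sup>+ x. (\<integral>\<^sup>+ z. (\<Sum>p\<in>P. indicator A (vadd d (vadd d x z) p)) \<partial>count_space ?Z)
       * indicator (unit_cube d) x \<partial>leb d)"
    using m by (intro nn_integral_tile) (auto intro!: borel_measurable_sum)
  also have "\<dots> = (\<integral>\<^sup>+ x. emeasure (count_space UNIV) {(p, z). p \<in> P \<and> z \<in> ?Z \<and> vadd d x (vadd d p z) \<in> A}
          * indicator (unit_cube d) x \<partial>leb d)"
  proof (intro nn_integral_cong arg_cong2[where f = "(*)"] refl)
    fix x :: "nat \<Rightarrow> real"
    let ?S = "{(p, z). p \<in> P \<and> z \<in> ?Z \<and> vadd d x (vadd d p z) \<in> A}"
    have "(\<integral>\<^sup>+ z. (\<Sum>p\<in>P. indicator A (vadd d (vadd d x z) p)) \<partial>count_space ?Z)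
        = (\<Sum>p\<in>P. \<integral>\<^sup>+ z. indicator A (vadd d (vadd d x z) p) \<partial>count_space ?Z)"
      by (rule nn_integral_sum) auto
    also have "\<dots> = (\<integral>\<^sup>+ p. (\<integral>\<^sup>+ z. indicator A (vadd d (vadd d x z) p) \<partial>count_space ?Z) \<partial>count_space P)"
      by (rule nn_integral_count_space_finite[OF P, symmetric])
    also have "\<dots> = (\<integral>\<^sup>+ p. (\<integral>\<^sup>+ z. indicator A (vadd d (vadd d x z) p) * indicator ?Z z \<partial>count_space UNIV)
         * indicator P p \<partial>count_space UNIV)"
      by (subst (1 2) nn_integral_count_space_indicator) simp_all
    also have "\<dots> = (\<integral>\<^sup>+ p. (\<integral>\<^sup>+ z. indicator ?S (p, z) \<partial>count_space UNIV) \<partial>count_space UNIV)"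
    proof (intro nn_integral_cong)
      fix p
      have "(\<integral>\<^sup>+ z. indicator A (vadd d (vadd d x z) p) * indicator ?Z z \<partial>count_space UNIV) * indicator P p
          = (\<integral>\<^sup>+ z. indicator A (vadd d (vadd d x z) p) * indicator ?Z z * indicator P p \<partial>count_space UNIV)"
        by (rule nn_integral_multc[symmetric]) auto
      also have "\<dots> = (\<integral>\<^sup>+ z. indicator ?S (p, z) \<partial>count_space UNIV)"
        by (intro nn_integral_cong) (auto simp: indicator_def vadd_assoc vadd_commute[of d p])
      finally show "(\<integral>\<^sup>+ z. indicator A (vadd d (vadd d x z) p) * indicator ?Z z \<partial>count_space UNIV) * indicator P p
          = (\<integral>\<^sup>+ z. indicator ?S (p, z) \<partial>count_space UNIV)" .
    qed
    also have "\<dots> = (\<integral>\<^sup>+ pz. indicator ?S pz \<partial>count_space UNIV)"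
      by (rule nn_integral_fst_count_space)
    also have "\<dots> = emeasure (count_space UNIV) ?S" by simp
    finally show "(\<integral>\<^sup>+ z. (\<Sum>p\<in>P. indicator A (vadd d (vadd d x z) p)) \<partial>count_space ?Z)
        = emeasure (count_space UNIV) ?S" .
  qed
  finally show ?thesis .
qed

text \<open>With the uniqueness below, this identifies the pairs counted in
  \<open>emeasure_unfold\<close> with the vectors of \<open>L\<close>.\<close>

lemma integration_lattice_decomp:
  assumes L: "integration_lattice d L" and g: "g \<in> L"
  shows "\<exists>p\<in>lattice_points d L. \<exists>z\<in>int_vectors d. vadd d p z = g"
proof -
  have lat: "is_lattice d L" and Z: "int_vectors d \<subseteq> L"
    using L by (auto simp: integration_lattice_def)
  let ?z = "vfloor d g" and ?p = "vadd d g (\<lambda>i. - vfloor d g i)"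
  have "?p \<in> L"
    using Z vfloor_int_vectors by (intro lattice_vdiff[OF lat g]) blast
  hence "?p \<in> lattice_points d L"
    using diff_in_unit_cube_iff[OF vfloor_int_vectors] by (auto simp: lattice_points_def)
  moreover have "vadd d ?p ?z = g"
    using lattice_subset[OF lat] g by (intro eucl_space_eqI[of _ d]) (auto simp: vadd_apply)
  ultimately show ?thesis using vfloor_int_vectors by blast
qed

lemma integration_lattice_decomp_unique:
  assumes "p \<in> lattice_points d L" "z \<in> int_vectors d" "p' \<in> lattice_points d L" "z' \<in> int_vectors d"
    and eq: "vadd d p z = vadd d p' z'"
  shows "p = p' \<and> z = z'"
proof -
  have *: "z = vfloor d (vadd d p z) \<and> vadd d (vadd d p z) (\<lambda>i. - z i) = p"
    if "p \<in> lattice_points d L" "z \<in> int_vectors d" for p z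
  proof -
    have p: "p \<in> unit_cube d" using that by (auto simp: lattice_points_def)
    hence "vadd d (vadd d p z) (\<lambda>i. - z i) = p"
      using unit_cube_subset by (intro eucl_space_eqI[of _ d]) (auto simp: vadd_apply)
    then show ?thesis using diff_in_unit_cube_iff[OF that(2)] p by metis
  qed
  from *[OF assms(1,2)] *[OF assms(3,4)] show ?thesis using eq by metis
qed

text \<open>
  The translates of \<open>A\<close> by the points of the unit cube contain \<open>N\<close> times the volume of \<open>A\<close> lattice
  points on average. Up to lattice vectors every such translation is one by a vector of sup norm at
  most \<open>r\<close>, which compares each of these numbers with the number of lattice points in \<open>C\<close>.
\<close>
lemma card_lattice_points_le:
  assumes L: "integration_lattice d L" and C: "C \<subseteq> unit_cube d" and A: "A \<in> sets (leb d)"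
    and cover: "\<And>x. x \<in> eucl_space d \<Longrightarrow> \<exists>g\<in>L. \<forall>i<d. \<bar>x i - g i\<bar> \<le> r"
    and sub: "\<And>c t. c \<in> C \<Longrightarrow> (\<And>i. i < d \<Longrightarrow> \<bar>t i\<bar> \<le> r) \<Longrightarrow> vadd d c t \<in> A"
  shows "of_nat (card (lattice_points d L \<inter> C)) \<le> of_nat (card (lattice_points d L)) * emeasure (leb d) A"
proof -
  let ?P = "lattice_points d L"
  let ?S = "\<lambda>x. {(p, z). p \<in> ?P \<and> z \<in> int_vectors d \<and> vadd d x (vadd d p z) \<in> A}"
  let ?I = "\<integral>\<^sup>+ x. emeasure (count_space UNIV) (?S x) * indicator (unit_cube d) x \<partial>leb d"
  have lat: "is_lattice d L" and Z: "int_vectors d \<subseteq> L"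
    using L by (auto simp: integration_lattice_def)
  have fin: "finite ?P" by (rule finite_lattice_points[OF lat])
  have unf: "of_nat (card ?P) * emeasure (leb d) A = ?I"
    by (rule emeasure_unfold[OF fin A])
  have const: "(\<integral>\<^sup>+ x. of_nat n * indicator (unit_cube d) x \<partial>leb d) = of_nat n" for n
    by (subst nn_integral_cmult_indicator) (auto simp: emeasure_unit_cube)
  have "of_nat (card (?P \<inter> C)) \<le> emeasure (count_space UNIV) (?S x)" if x: "x \<in> unit_cube d" for x
  proof -
    obtain g where g: "g \<in> L" "\<And>i. i < d \<Longrightarrow> \<bar>x i - g i\<bar> \<le> r"
      using cover x unit_cube_subset by blast
    \<comment> \<open>The lattice vector \<open>c - g\<close> moves \<open>x\<close> to
      \<open>c + (x - g)\<close>, a displacement of \<open>c\<close> by at most \<open>r\<close>,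
      hence a point of \<open>A\<close>. Distinct \<open>c\<close> give distinct pairs.\<close>
    let ?u = "\<lambda>c. vadd d c (\<lambda>i. - g i)"
    have "\<exists>pz. fst pz \<in> ?P \<and> snd pz \<in> int_vectors d \<and> vadd d (fst pz) (snd pz) = ?u c" if "c \<in> ?P \<inter> C" for c
    proof -
      have "?u c \<in> L"
        using that by (intro lattice_vdiff[OF lat _ g(1)]) (auto simp: lattice_points_def)
      from integration_lattice_decomp[OF L this] show ?thesis by auto
    qed
    then obtain f where f: "\<And>c. c \<in> ?P \<inter> C \<Longrightarrow> fst (f c) \<in> ?P \<and> snd (f c) \<in> int_vectors d
          \<and> vadd d (fst (f c)) (snd (f c)) = ?u c"
      by metis
    have "inj_on f (?P \<inter> C)"
    proof (rule inj_onI)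
      fix b c assume bc: "b \<in> ?P \<inter> C" "c \<in> ?P \<inter> C" "f b = f c"
      hence "?u b = ?u c" using f by metis
      have "b i = c i" if "i < d" for i
      proof -
        have "?u b i = ?u c i" by (simp only: \<open>?u b = ?u c\<close>)
        with that show ?thesis by (simp add: vadd_apply)
      qed
      then show "b = c" using bc C unit_cube_subset by (intro eucl_space_eqI[of _ d]) auto
    qed
    moreover have "f ` (?P \<inter> C) \<subseteq> ?S x"
    proof
      fix q assume "q \<in> f ` (?P \<inter> C)"
      then obtain c where c: "c \<in> ?P \<inter> C" "q = f c" by auto
      have "vadd d x (?u c) = vadd d c (\<lambda>i. x i - g i)"
        by (auto simp: vadd_def)
      also have "\<dots> \<in> A" using c g by (intro sub) auto
      finally have A': "vadd d x (?u c) \<in> A" .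
      obtain p z where q: "q = (p, z)" by (cases q)
      show "q \<in> ?S x" using f[OF c(1)] A' unfolding c(2)[symmetric] q by simp
    qed
    ultimately show ?thesis
      using fin emeasure_mono[of "f ` (?P \<inter> C)" "?S x" "count_space UNIV"]
      by (simp add: emeasure_count_space_finite card_image)
  qed
  hence "(\<integral>\<^sup>+ x. of_nat (card (?P \<inter> C)) * indicator (unit_cube d) x \<partial>leb d) \<le> ?I"
    by (intro nn_integral_mono) (auto simp: indicator_def)
  then show ?thesis unfolding unf const .
qed

text \<open>The opposite injection: a pair with \<open>x + p + z\<close> in \<open>A\<close> is sent
  to \<open>p + z + g\<close>, which differs from that point by \<open>g - x\<close>. It lands in
  \<open>C\<close>, hence in the cube, and so is one of the counted lattice points.\<close>

lemma card_lattice_points_ge: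
  assumes L: "integration_lattice d L" and C: "C \<subseteq> unit_cube d" and A: "A \<in> sets (leb d)"
    and cover: "\<And>x. x \<in> eucl_space d \<Longrightarrow> \<exists>g\<in>L. \<forall>i<d. \<bar>x i - g i\<bar> \<le> r"
    and sub: "\<And>a t. a \<in> A \<Longrightarrow> (\<And>i. i < d \<Longrightarrow> \<bar>t i\<bar> \<le> r) \<Longrightarrow> vadd d a t \<in> C"
  shows "of_nat (card (lattice_points d L)) * emeasure (leb d) A \<le> of_nat (card (lattice_points d L \<inter> C))"
proof -
  let ?P = "lattice_points d L"
  let ?S = "\<lambda>x. {(p, z). p \<in> ?P \<and> z \<in> int_vectors d \<and> vadd d x (vadd d p z) \<in> A}"
  let ?I = "\<integral>\<^sup>+ x. emeasure (count_space UNIV) (?S x) * indicator (unit_cube d) x \<partial>leb d"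
  have lat: "is_lattice d L" and Z: "int_vectors d \<subseteq> L"
    using L by (auto simp: integration_lattice_def)
  have fin: "finite ?P" by (rule finite_lattice_points[OF lat])
  have unf: "of_nat (card ?P) * emeasure (leb d) A = ?I"
    by (rule emeasure_unfold[OF fin A])
  have const: "(\<integral>\<^sup>+ x. of_nat n * indicator (unit_cube d) x \<partial>leb d) = of_nat n" for n
    by (subst nn_integral_cmult_indicator) (auto simp: emeasure_unit_cube)
  have "emeasure (count_space UNIV) (?S x) \<le> of_nat (card (?P \<inter> C))" if x: "x \<in> unit_cube d" for x
  proof -
    obtain g where g: "g \<in> L" "\<And>i. i < d \<Longrightarrow> \<bar>x i - g i\<bar> \<le> r"
      using cover x unit_cube_subset by blast
    let ?f = "\<lambda>(p, z). vadd d (vadd d p z) g"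
    have "inj_on ?f (?S x)"
    proof (rule inj_onI)
      fix q q' assume "q \<in> ?S x" "q' \<in> ?S x" and eq: "?f q = ?f q'"
      then obtain p z p' z' where q: "q = (p, z)" "q' = (p', z')"
        and pz: "p \<in> ?P" "z \<in> int_vectors d" "p' \<in> ?P" "z' \<in> int_vectors d" by auto
      have "vadd d p z = vadd d p' z'"
      proof (rule eucl_space_eqI[of _ d])
        fix i assume "i < d"
        then show "vadd d p z i = vadd d p' z' i"
          using fun_cong[OF eq, of i] by (simp add: q vadd_apply)
      qed auto
      with integration_lattice_decomp_unique[OF pz] show "q = q'" by (simp add: q)
    qed
    moreover have "?f ` ?S x \<subseteq> ?P \<inter> C"
    proof (rule image_subsetI)
      fix q assume "q \<in> ?S x"
      then obtain p z where q: "q = (p, z)" and p: "p \<in> ?P" and z: "z \<in> int_vectors d"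
        and a: "vadd d x (vadd d p z) \<in> A" by auto
      have "vadd d (vadd d p z) g \<in> L"
        using p z g(1) Z by (intro lattice_vadd[OF lat]) (auto simp: lattice_points_def)
      moreover have "vadd d (vadd d p z) g = vadd d (vadd d x (vadd d p z)) (\<lambda>i. g i - x i)"
        by (auto simp: vadd_def)
      moreover have "\<dots> \<in> C" using g a by (intro sub) (auto simp: abs_minus_commute)
      ultimately show "?f q \<in> ?P \<inter> C"
        using C by (auto simp: lattice_points_def q)
    qed
    moreover have "finite (?P \<inter> C)" using fin by simp
    ultimately have "finite (?S x)" "card (?S x) \<le> card (?P \<inter> C)"
      by (rule inj_on_finite, rule card_inj_on_le)
    then show ?thesis by (simp add: emeasure_count_space_finite)
  qed
  hence "?I \<le> (\<integral>\<^sup>+ x. of_nat (card (?P \<inter> C)) * indicator (unit_cube d) x \<partial>leb d)"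
    by (intro nn_integral_mono) (auto simp: indicator_def)
  then show ?thesis unfolding unf const .
qed

section \<open>The upper bound\<close>

lemma emeasure_dilate_le:
  assumes C: "C \<subseteq> unit_cube d" "convex_set d C" and \<eta>: "0 \<le> \<eta>" "0 \<le> \<delta>"
  shows "emeasure (leb d) (dilate d \<eta> C) \<le> emeasure (leb d) (erode \<delta> (dilate d \<eta> C) d)
      + ennreal (real d * (2 * \<delta> * (1 + 2 * \<eta>) ^ (d - 1)))"
proof -
  have le: "- \<eta> \<le> 1 + \<eta>" and eq: "1 + \<eta> - - \<eta> = 1 + 2 * \<eta>" using \<eta>(1) by auto
  show ?thesis
    using emeasure_erode[OF convex_set_dilate[OF C(2)] sets_dilate
        dilate_unit_cube_subset[OF C(1), of \<eta>] \<eta>(2) le order_refl]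
    unfolding eq .
qed

lemma emeasure_dilate_finite:
  assumes "C \<subseteq> unit_cube d" "0 \<le> \<eta>"
  shows "emeasure (leb d) (dilate d \<eta> C) < \<infinity>"
proof -
  have "emeasure (leb d) (dilate d \<eta> C) \<le> emeasure (leb d) ({..<d} \<rightarrow>\<^sub>E {-\<eta>..1 + \<eta>})"
    by (intro emeasure_mono dilate_unit_cube_subset[OF assms(1)] sets_box) simp
  also have "\<dots> < \<infinity>" using assms(2) by (subst emeasure_box) auto
  finally show ?thesis .
qed

lemma erode_dilate_subset_self:
  assumes "convex_set d C" "C \<subseteq> eucl_space d" "0 \<le> \<eta>"
  shows "erode \<eta> (dilate d \<eta> C) d \<subseteq> C"
proof
  fix x assume x: "x \<in> erode \<eta> (dilate d \<eta> C) d"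
  have "erode \<eta> (dilate d \<eta> C) d \<in> sets (leb d)"
    using erode_basic[OF convex_set_dilate[OF assms(1)] sets_dilate assms(3) order_refl] by auto
  with x have "x \<in> eucl_space d"
    using sets.sets_into_space[of _ "leb d"] unfolding space_leb by blast
  moreover have "(\<lambda>i\<in>{..<d}. x i + 0) \<in> C"
    by (rule erode_dilate_subset[OF assms order_refl]) (use x in auto)
  ultimately show "x \<in> C" by (simp add: eucl_space_restrict)
qed

text \<open>\<open>C\<close> lies between two Borel sets of equal finite measure: the union of the
  eroded neighbourhoods of radius 1 / (n + 1) and the intersection of the neighbourhoods
  themselves.\<close>

lemma convex_set_completion_sets:
  assumes C: "C \<subseteq> unit_cube d" "convex_set d C"
  shows "C \<in> sets (completion (leb d))"
proof -
  have Ce: "C \<subseteq> eucl_space d" using C(1) unit_cube_subset by blast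
  define W where "W n = dilate d (1 / real (Suc n)) C" for n
  define E where "E n = erode (1 / real (Suc n)) (W n) d" for n
  define A where "A = (\<Union>n. E n)"
  define B where "B = (\<Inter>n. W n)"
  have W: "W n \<in> sets (leb d)" for n by (simp add: W_def sets_dilate)
  have E: "E n \<in> sets (leb d)" for n
    using erode_basic[OF convex_set_dilate[OF C(2)] sets_dilate _ order_refl] by (auto simp: E_def W_def)
  have A: "A \<in> sets (leb d)" and B: "B \<in> sets (leb d)"
    using W E by (auto simp: A_def B_def)
  have AC: "A \<subseteq> C"
    unfolding A_def E_def W_def by (intro UN_least erode_dilate_subset_self C(2) Ce) simp
  have CB: "C \<subseteq> B"
    unfolding B_def W_def by (intro INT_greatest subset_dilate Ce) simp
  have "emeasure (leb d) B \<le> emeasure (leb d) A"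
  proof (rule ennreal_le_epsilon)
    fix e :: real assume e: "0 < e"
    \<comment> \<open>The loss at stage \<open>n\<close> is at most \<open>c / (n + 1)\<close>; the
      3 bounds 1 + 2 / (n + 1).\<close>
    define c where "c = real d * (2 * 3 ^ (d - 1))"
    have c: "0 \<le> c" by (simp add: c_def)
    obtain n :: nat where n: "c / e < real n" using reals_Archimedean2 by blast
    have "c * (1 / real (Suc n)) \<le> e"
      using n e c by (simp add: field_simps)
    have "emeasure (leb d) B \<le> emeasure (leb d) (W n)"
      by (intro emeasure_mono W) (auto simp: B_def)
    also have "\<dots> \<le> emeasure (leb d) (E n)
        + ennreal (real d * (2 * (1 / real (Suc n)) * (1 + 2 * (1 / real (Suc n))) ^ (d - 1)))"
      unfolding W_def E_def by (intro emeasure_dilate_le C) auto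
    also have "\<dots> \<le> emeasure (leb d) A + ennreal e"
    proof (intro add_mono emeasure_mono ennreal_leI A)
      have "(1 + 2 * (1 / real (Suc n))) ^ (d - 1) \<le> 3 ^ (d - 1)"
        by (intro power_mono) (auto simp: divide_simps)
      hence "real d * (2 * (1 / real (Suc n)) * (1 + 2 * (1 / real (Suc n))) ^ (d - 1))
          \<le> real d * (2 * (1 / real (Suc n)) * 3 ^ (d - 1))"
        by (intro mult_left_mono) auto
      also have "\<dots> = c * (1 / real (Suc n))" by (simp add: c_def)
      finally show "real d * (2 * (1 / real (Suc n)) * (1 + 2 * (1 / real (Suc n))) ^ (d - 1)) \<le> e"
        using \<open>c * (1 / real (Suc n)) \<le> e\<close> by linarith
    qed (auto simp: A_def)
    finally show "emeasure (leb d) B \<le> emeasure (leb d) A + ennreal e" .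
  qed
  with emeasure_mono[OF subset_trans[OF AC CB] B]
  have eq: "emeasure (leb d) A = emeasure (leb d) B" by (rule antisym)
  have "emeasure (leb d) B \<le> emeasure (leb d) (W 0)"
    by (intro emeasure_mono W) (auto simp: B_def)
  also have "\<dots> < \<infinity>" unfolding W_def by (intro emeasure_dilate_finite C) auto
  finally have fin: "emeasure (leb d) B < \<infinity>" .
  show ?thesis
    by (rule completion.complete_sets_sandwich[OF _ _ AC CB]) (use A B eq fin in auto)
qed

lemma volume_sandwich:
  assumes C: "C \<subseteq> unit_cube d" "convex_set d C"
    and A: "A \<in> sets (leb d)" "A \<subseteq> C"
    and B: "B \<in> sets (leb d)" "C \<subseteq> B" "emeasure (leb d) B < \<infinity>"
  shows "measure (leb d) A \<le> volume d C" "volume d C \<le> measure (leb d) B"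
proof -
  have Cs: "C \<in> sets (completion (leb d))" by (rule convex_set_completion_sets[OF C])
  have Bf: "B \<in> fmeasurable (completion (leb d))"
    using B by (auto simp: fmeasurable_def)
  have Cf: "C \<in> fmeasurable (completion (leb d))"
    by (rule fmeasurableI2[OF Bf B(2) Cs])
  show "measure (leb d) A \<le> volume d C"
    using measure_mono_fmeasurable[OF A(2) _ Cf] A(1) by (simp add: volume_def)
  show "volume d C \<le> measure (leb d) B"
    using measure_mono_fmeasurable[OF B(2) Cs Bf] B(1) by (simp add: volume_def)
qed

lemma volume_le_1:
  assumes "C \<subseteq> unit_cube d" "convex_set d C"
  shows "0 \<le> volume d C" "volume d C \<le> 1"
  using volume_sandwich[OF assms, of "{}" "unit_cube d"] assms(1) emeasure_unit_cube[of d]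
  by (auto simp: measure_def)

lemma zero_in_lattice_points:
  assumes "integration_lattice d L"
  shows "zero_vector d \<in> lattice_points d L"
proof -
  have "zero_vector d \<in> int_vectors d" by (auto simp: zero_vector_def)
  hence "zero_vector d \<in> L" using assms by (auto simp: integration_lattice_def)
  then show ?thesis by (simp add: lattice_points_def unit_cube_def) (simp add: zero_vector_def)
qed

lemma card_lattice_points_pos:
  assumes "integration_lattice d L"
  shows "0 < card (lattice_points d L)"
  using zero_in_lattice_points[OF assms] finite_lattice_points[of d L] assms
  by (auto simp: card_gt_0_iff integration_lattice_def)

text \<open>Both quantities lie between 0 and 1. This makes the supremum in
  \<open>isotropic_discrepancy\<close> a bounded one, and it settles the upper bound when the
  right-hand side is at least 1.\<close>

lemma local_discrepancy_le_1:
  assumes "integration_lattice d L" "C \<subseteq> unit_cube d" "convex_set d C"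
  shows "\<bar>real (card (lattice_points d L \<inter> C)) / real (card (lattice_points d L)) - volume d C\<bar> \<le> 1"
proof -
  have "card (lattice_points d L \<inter> C) \<le> card (lattice_points d L)"
    using assms(1) by (intro card_mono finite_lattice_points) (auto simp: integration_lattice_def)
  hence "real (card (lattice_points d L \<inter> C)) / real (card (lattice_points d L)) \<le> 1"
    using card_lattice_points_pos[OF assms(1)] by simp
  moreover have "0 \<le> real (card (lattice_points d L \<inter> C)) / real (card (lattice_points d L))" by simp
  ultimately show ?thesis using volume_le_1[OF assms(2,3)] by linarith
qed

text \<open>The strict \<open>r < D\<close> lets the open neighbourhood \<open>W\<close> absorb the
  closed range of displacements up to \<open>r\<close>.\<close>

lemma local_discrepancy_le:
  assumes L: "integration_lattice d L" and C: "C \<subseteq> unit_cube d" "convex_set d C"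
    and cover: "\<And>x. x \<in> eucl_space d \<Longrightarrow> \<exists>g\<in>L. \<forall>i<d. \<bar>x i - g i\<bar> \<le> r"
    and r: "0 \<le> r" "r < D"
  shows "\<bar>real (card (lattice_points d L \<inter> C)) / real (card (lattice_points d L)) - volume d C\<bar>
     \<le> 4 * real d * D * (1 + 2 * D) ^ (d - 1)"
proof -
  let ?P = "lattice_points d L"
  define N where "N = card ?P"
  have N: "0 < N" unfolding N_def by (rule card_lattice_points_pos[OF L])
  have D: "0 < D" using r by simp
  have Ce: "C \<subseteq> eucl_space d" using C(1) unit_cube_subset by blast
  define W where "W = dilate d D C"
  \<comment> \<open>One \<open>D\<close> undoes the dilation from \<open>C\<close> to
    \<open>W\<close>; the other leaves room inside \<open>C\<close> for the displacements of lattice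
    points.\<close>
  define E where "E = erode (D + D) W d"
  have W: "W \<in> sets (leb d)" by (simp add: W_def sets_dilate)
  have E: "E \<in> sets (leb d)" "E \<subseteq> W"
    using erode_basic[OF convex_set_dilate[OF C(2)] sets_dilate _ order_refl] D by (auto simp: E_def W_def)
  have CW: "C \<subseteq> W" unfolding W_def by (rule subset_dilate[OF Ce D])
  have EC: "vadd d x t \<in> C" if "x \<in> E" "\<And>i. i < d \<Longrightarrow> \<bar>t i\<bar> \<le> D" for x t
    unfolding vadd_def using erode_dilate_subset[OF C(2) Ce, of D D x t] that D
    by (auto simp: E_def W_def)
  have "E \<subseteq> C"
  proof
    fix x assume x: "x \<in> E"
    with E have "x \<in> eucl_space d" using sets.sets_into_space[OF E(1)] unfolding space_leb by blast
    with EC[OF x, of "\<lambda>_. 0"] D show "x \<in> C" by (simp add: vadd_def eucl_space_restrict)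
  qed
  have Wfin: "emeasure (leb d) W < \<infinity>"
    unfolding W_def using D by (intro emeasure_dilate_finite C) auto
  have Efin: "emeasure (leb d) E < \<infinity>"
    using emeasure_mono[OF E(2) W] Wfin by (simp add: order_le_less_trans)
  have emW: "emeasure (leb d) W = ennreal (measure (leb d) W)"
    and emE: "emeasure (leb d) E = ennreal (measure (leb d) E)"
    using Wfin Efin by (simp_all add: emeasure_eq_ennreal_measure less_top)
  have vol: "measure (leb d) E \<le> volume d C" "volume d C \<le> measure (leb d) W"
    using volume_sandwich[OF C E(1) \<open>E \<subseteq> C\<close> W CW Wfin] by auto
  have "of_nat (card (?P \<inter> C)) \<le> of_nat N * emeasure (leb d) W"
    unfolding N_def
  proof (rule card_lattice_points_le[OF L C(1) W cover])
    fix c t assume ct: "c \<in> C" "\<And>i. i < d \<Longrightarrow> \<bar>t i\<bar> \<le> r"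
    hence "\<bar>t i\<bar> < D" if "i < d" for i using that r by force
    with ct(1) show "vadd d c t \<in> W"
      unfolding W_def dilate_def by (auto simp: vadd_apply intro!: bexI[of _ c])
  qed
  hence "ennreal (real (card (?P \<inter> C))) \<le> ennreal (real N * measure (leb d) W)"
    by (simp add: emW ennreal_mult ennreal_of_nat_eq_real_of_nat)
  hence up: "real (card (?P \<inter> C)) \<le> real N * measure (leb d) W"
    by (subst (asm) ennreal_le_iff) auto
  have "of_nat N * emeasure (leb d) E \<le> of_nat (card (?P \<inter> C))"
    unfolding N_def
  proof (rule card_lattice_points_ge[OF L C(1) E(1) cover])
    fix a t assume at: "a \<in> E" "\<And>i. i < d \<Longrightarrow> \<bar>t i\<bar> \<le> r"
    show "vadd d a t \<in> C" using at r by (intro EC) force+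
  qed
  hence "ennreal (real N * measure (leb d) E) \<le> ennreal (real (card (?P \<inter> C)))"
    by (simp add: emE ennreal_mult ennreal_of_nat_eq_real_of_nat)
  hence lo: "real N * measure (leb d) E \<le> real (card (?P \<inter> C))"
    by (subst (asm) ennreal_le_iff) auto
  let ?c = "real d * (2 * (D + D) * (1 + 2 * D) ^ (d - 1))"
  have c: "0 \<le> ?c" using D by simp
  have "emeasure (leb d) W \<le> emeasure (leb d) E + ennreal ?c"
    unfolding W_def E_def using D by (intro emeasure_dilate_le C) auto
  hence "ennreal (measure (leb d) W) \<le> ennreal (measure (leb d) E + ?c)"
    using c by (simp add: emW emE ennreal_plus)
  hence "measure (leb d) W \<le> measure (leb d) E + ?c"
    using c by (subst (asm) ennreal_le_iff) (auto intro!: add_nonneg_nonneg)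
  moreover have "measure (leb d) E \<le> real (card (?P \<inter> C)) / real N"
    "real (card (?P \<inter> C)) / real N \<le> measure (leb d) W"
    using up lo N by (simp_all add: field_simps)
  ultimately have "\<bar>real (card (?P \<inter> C)) / real N - volume d C\<bar> \<le> ?c"
    using vol by linarith
  also have "?c = 4 * real d * D * (1 + 2 * D) ^ (d - 1)" by simp
  finally show ?thesis unfolding N_def .
qed

text \<open>For \<open>d\<close> at least 2 the chain is exp ((d - 1) x), then exp (1 / 2), then 2,
  then \<open>d\<close>; for \<open>d = 1\<close> the power is empty. The bound \<open>d\<close>
  supplies the second factor \<open>d\<close> of the upper bound.\<close>

lemma one_plus_power_le:
  fixes x :: real
  assumes "1 \<le> d" "0 \<le> x" "x \<le> 1 / (2 * real d ^ 2)"
  shows "(1 + x) ^ (d - 1) \<le> real d"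
proof (cases "d = 1")
  case False
  with assms have d: "2 \<le> d" by auto
  have "(1 + x) ^ (d - 1) \<le> exp x ^ (d - 1)"
    using assms by (intro power_mono) auto
  also have "\<dots> = exp (real (d - 1) * x)" by (simp add: exp_of_nat_mult)
  also have "\<dots> \<le> exp (1 / 2)"
  proof -
    have "real (d - 1) * x \<le> real d * (1 / (2 * real d ^ 2))"
      using assms by (intro mult_mono) auto
    also have "\<dots> \<le> 1 / 2" using d by (simp add: power2_eq_square field_simps)
    finally show ?thesis by simp
  qed
  also have "\<dots> \<le> 2" by (rule exp_half_le2)
  finally show ?thesis using d by simp
qed simp

lemma isotropic_discrepancy_upper:
  assumes d: "d \<ge> 1" and L: "integration_lattice d L"
  shows "isotropic_discrepancy d (card (lattice_points d L)) (lattice_points d L)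
    \<le> real d ^ 2 * 2 ^ d * spectral_test d L"
  unfolding isotropic_discrepancy_def
proof (rule cSUP_least)
  have "{} \<in> {C. C \<subseteq> unit_cube d \<and> convex_set d C}" by (simp add: convex_set_def)
  then show "{C. C \<subseteq> unit_cube d \<and> convex_set d C} \<noteq> {}" by blast
next
  fix C assume "C \<in> {C. C \<subseteq> unit_cube d \<and> convex_set d C}"
  hence C: "C \<subseteq> unit_cube d" "convex_set d C" by auto
  let ?\<sigma> = "spectral_test d L"
  let ?J = "\<bar>real (card (lattice_points d L \<inter> C)) / real (card (lattice_points d L)) - volume d C\<bar>"
  have \<sigma>: "0 \<le> ?\<sigma>"
    using spectral_test_attained[OF d L] by (metis divide_nonneg_nonneg dot_self_nonneg real_sqrt_ge_zero zero_le_one)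
  show "?J \<le> real d ^ 2 * 2 ^ d * ?\<sigma>"
  proof (cases "1 \<le> real d ^ 2 * 2 ^ d * ?\<sigma>")
    case True
    with local_discrepancy_le_1[OF L C] show ?thesis by linarith
  next
    case False
    define r where "r = 2 ^ d / 4 * ?\<sigma>"
    define f where "f D = 4 * real d * D * (1 + 2 * D) ^ (d - 1)" for D :: real
    have r: "0 \<le> r" using \<sigma> by (simp add: r_def)
    have "?J \<le> f D" if "r < D" for D
      unfolding f_def using lattice_covering[OF d L, folded r_def] r that
      by (intro local_discrepancy_le[OF L C]) auto
    \<comment> \<open>The estimate holds for every \<open>D\<close> above \<open>r\<close> only, so
      it is carried to \<open>r\<close> by continuity of \<open>f\<close> from the right.\<close>
    hence "eventually (\<lambda>D. ?J \<le> f D) (at_right r)"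
      by (auto simp: eventually_at_right_less intro: eventually_mono[OF eventually_at_right_less])
    moreover have "(f \<longlongrightarrow> f r) (at_right r)"
      unfolding f_def by (intro tendsto_intros)
    ultimately have "?J \<le> f r"
      by (intro tendsto_lowerbound[of f "f r" "at_right r"]) auto
    also have "f r \<le> 4 * real d * r * real d"
      unfolding f_def
    proof (intro mult_left_mono one_plus_power_le d)
      have "2 * r * (2 * real d ^ 2) \<le> 1" using False by (simp add: r_def algebra_simps)
      with d show "2 * r \<le> 1 / (2 * real d ^ 2)" by (simp add: field_simps)
    qed (use r in auto)
    also have "\<dots> = real d ^ 2 * 2 ^ d * ?\<sigma>"
      by (simp add: r_def power2_eq_square)
    finally show ?thesis .
  qed
qed

section \<open>The lower bounds\<close>

lemma measurable_dot: "(\<lambda>x. dot d h x) \<in> borel_measurable (leb d)"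
  unfolding dot_def by measurable

text \<open>Fubini along a coordinate where \<open>h\<close> does not vanish: each fibre has at most
  one point.\<close>

lemma hyperplane_null:
  assumes "dot d h h \<noteq> 0"
  shows "{x \<in> space (leb d). dot d h x = c} \<in> null_sets (leb d)"
proof -
  let ?H = "{x \<in> space (leb d). dot d h x = c}"
  obtain i where i: "i < d" "h i \<noteq> 0" using assms dot_self_eq_0_iff by blast
  define I where "I = {..<d} - {i}"
  have I: "finite I" "i \<notin> I" "insert i I = {..<d}" using i by (auto simp: I_def)
  have H: "?H \<in> sets (leb d)"
    using measurable_dot[of d h] by measurable
  hence H': "?H \<in> sets (Pi\<^sub>M (insert i I) (\<lambda>_. lborel))" by (simp add: I)
  have "emeasure (leb d) ?H = (\<integral>\<^sup>+ x. indicator ?H x \<partial>Pi\<^sub>M (insert i I) (\<lambda>_. lborel))"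
    using H by (simp add: I)
  also have "\<dots> = (\<integral>\<^sup>+ x. (\<integral>\<^sup>+ y. indicator ?H (x(i := y)) \<partial>lborel) \<partial>Pi\<^sub>M I (\<lambda>_. lborel))"
    using H' I by (intro lborel_prod.product_nn_integral_insert) auto
  also have "\<dots> = (\<integral>\<^sup>+ x. 0 \<partial>(Pi\<^sub>M I (\<lambda>_. lborel) :: (nat \<Rightarrow> real) measure))"
  proof (rule nn_integral_cong)
    fix x :: "nat \<Rightarrow> real"
    let ?y = "(c - (\<Sum>j\<in>I. h j * x j)) / h i"
    have "dot d h (x(i := y)) = h i * y + (\<Sum>j\<in>I. h j * x j)" for y
    proof -
      have "dot d h (x(i := y)) = (\<Sum>j\<in>insert i I. h j * (x(i := y)) j)"
        unfolding dot_def I(3) ..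
      also have "\<dots> = h i * y + (\<Sum>j\<in>I. h j * (x(i := y)) j)"
        using sum.insert[OF I(1,2), of "\<lambda>j. h j * (x(i := y)) j"] by (simp only: fun_upd_same)
      also have "(\<Sum>j\<in>I. h j * (x(i := y)) j) = (\<Sum>j\<in>I. h j * x j)"
        using I by (intro sum.cong) auto
      finally show ?thesis .
    qed
    hence "y = ?y" if "x(i := y) \<in> ?H" for y
      using that i by (auto simp: field_simps)
    hence "(\<integral>\<^sup>+ y. indicator ?H (x(i := y)) \<partial>lborel) \<le> (\<integral>\<^sup>+ y. indicator {?y} y \<partial>lborel)"
      by (intro nn_integral_mono) (auto simp: indicator_def)
    also have "\<dots> = 0" by simp
    finally show "(\<integral>\<^sup>+ y. indicator ?H (x(i := y)) \<partial>lborel) = 0" by simp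
  qed
  finally show ?thesis using H by (intro null_setsI) simp_all
qed

definition slab :: "nat \<Rightarrow> (nat \<Rightarrow> real) \<Rightarrow> int \<Rightarrow> (nat \<Rightarrow> real) set" where
  "slab d h k = {x \<in> unit_cube d. of_int k < dot d h x \<and> dot d h x < of_int k + 1}"

lemma slab_subset: "slab d h k \<subseteq> unit_cube d"
  by (auto simp: slab_def)

lemma sets_slab: "slab d h k \<in> sets (leb d)"
proof -
  have "slab d h k = unit_cube d \<inter> {x \<in> space (leb d). of_int k < dot d h x \<and> dot d h x < of_int k + 1}"
    using unit_cube_subset by (auto simp: slab_def space_leb)
  also have "\<dots> \<in> sets (leb d)"
    using measurable_dot[of d h] by measurable
  finally show ?thesis .
qed

lemma convex_set_unit_cube: "convex_set d (unit_cube d)"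
  unfolding convex_set_def
proof (intro ballI allI impI)
  fix x y and u v :: real
  assume xy: "x \<in> unit_cube d" "y \<in> unit_cube d" and uv: "0 \<le> u" "0 \<le> v" "u + v = 1"
  have "u * x i + v * y i \<in> {0..<1}" if "i < d" for i
  proof -
    have "x i \<in> {0..<1}" "y i \<in> {0..<1}"
      using xy that unfolding unit_cube_def by (blast dest: PiE_mem)+
    with uv show ?thesis using convex_bound_lt[of "x i" 1 "y i" u v] by auto
  qed
  then show "(\<lambda>i\<in>{..<d}. u * x i + v * y i) \<in> unit_cube d"
    by (auto simp: unit_cube_def)
qed

lemma convex_set_slab: "convex_set d (slab d h k)"
  unfolding convex_set_def
proof (intro ballI allI impI)
  fix x y and u v :: real
  assume x: "x \<in> slab d h k" and y: "y \<in> slab d h k" and uv: "0 \<le> u" "0 \<le> v" "u + v = 1"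
  have "u * dot d h x + v * dot d h y < of_int k + 1"
    using x y uv by (intro convex_bound_lt) (auto simp: slab_def)
  moreover have "u * (- dot d h x) + v * (- dot d h y) < - of_int k"
    using x y uv by (intro convex_bound_lt) (auto simp: slab_def)
  moreover have "(\<lambda>i\<in>{..<d}. u * x i + v * y i) \<in> unit_cube d"
    using x y uv by (intro convex_setD[OF convex_set_unit_cube]) (auto simp: slab_def)
  ultimately show "(\<lambda>i\<in>{..<d}. u * x i + v * y i) \<in> slab d h k"
    by (simp add: slab_def dot_lincomb_right)
qed

text \<open>An integer cannot lie strictly between consecutive integers, so the slab misses the
  lattice and its local discrepancy is its volume. The slab is Borel, so \<open>volume\<close>
  agrees with \<open>measure (leb d)\<close> on it.\<close>

lemma measure_slab_le_isotropic_discrepancy: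
  assumes L: "integration_lattice d L" and h: "h \<in> dual_lattice d L"
  shows "measure (leb d) (slab d h k) \<le> isotropic_discrepancy d (card (lattice_points d L)) (lattice_points d L)"
proof -
  let ?f = "\<lambda>C. \<bar>real (card (lattice_points d L \<inter> C)) / real (card (lattice_points d L)) - volume d C\<bar>"
  let ?\<C> = "{C. C \<subseteq> unit_cube d \<and> convex_set d C}"
  have "lattice_points d L \<inter> slab d h k = {}"
  proof -
    have "\<not> (of_int k < dot d h x \<and> dot d h x < of_int k + 1)" if "x \<in> L" for x
    proof -
      obtain m :: int where "dot d h x = of_int m"
        using h \<open>x \<in> L\<close> by (auto simp: dual_lattice_def elim: Ints_cases)
      then show ?thesis by simp
    qed
    then show ?thesis by (auto simp: lattice_points_def slab_def)
  qed
  hence "?f (slab d h k) = measure (leb d) (slab d h k)"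
    using sets_slab[of d h k] by (simp add: volume_def)
  moreover have "?f (slab d h k) \<le> (SUP C\<in>?\<C>. ?f C)"
  proof (rule cSUP_upper)
    show "slab d h k \<in> ?\<C>" using slab_subset convex_set_slab by blast
    show "bdd_above (?f ` ?\<C>)"
      by (rule bdd_aboveI[of _ 1]) (use local_discrepancy_le_1[OF L] in auto)
  qed
  ultimately show ?thesis unfolding isotropic_discrepancy_def by simp
qed

lemma isotropic_discrepancy_nonneg:
  assumes "integration_lattice d L" "h \<in> dual_lattice d L"
  shows "0 \<le> isotropic_discrepancy d (card (lattice_points d L)) (lattice_points d L)"
  using measure_slab_le_isotropic_discrepancy[OF assms, of 0] measure_nonneg[of "leb d"]
  by (rule order_trans[rotated])

text \<open>Common core of both lower bounds, which differ in the region \<open>B\<close> and the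
  slabs \<open>K\<close> that cover it. Points with integral \<open>dot d h x\<close> lie in no
  slab, but on countably many null hyperplanes.\<close>

lemma measure_le_slab_count:
  assumes L: "integration_lattice d L" and h: "h \<in> dual_lattice d L" "dot d h h \<noteq> 0"
    and B: "B \<in> sets (leb d)" "B \<subseteq> unit_cube d" and K: "finite K"
    and cover: "\<And>x. x \<in> B \<Longrightarrow> \<lfloor>dot d h x\<rfloor> \<in> K \<or> dot d h x \<in> \<int>"
  shows "measure (leb d) B \<le> real (card K) * isotropic_discrepancy d (card (lattice_points d L)) (lattice_points d L)"
proof -
  let ?J = "isotropic_discrepancy d (card (lattice_points d L)) (lattice_points d L)"
  let ?N = "\<Union>m::int. {x \<in> space (leb d). dot d h x = of_int m}"
  have N: "?N \<in> null_sets (leb d)"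
    by (intro null_sets_UN hyperplane_null h)
  have fin: "emeasure (leb d) (slab d h k) \<noteq> \<infinity>" for k
    using emeasure_mono[OF slab_subset sets_unit_cube, of d h k] emeasure_unit_cube[of d] 
    by (auto simp: top_unique)
  have U: "(\<Union>k\<in>K. slab d h k) \<in> sets (leb d)"
    using K sets_slab by auto
  have "B \<subseteq> (\<Union>k\<in>K. slab d h k) \<union> ?N"
  proof
    fix x assume x: "x \<in> B"
    have sp: "x \<in> space (leb d)" using x B(2) unit_cube_subset by (auto simp: space_leb)
    show "x \<in> (\<Union>k\<in>K. slab d h k) \<union> ?N"
    proof (cases "dot d h x \<in> \<int>")
      case True
      then show ?thesis using sp by (auto elim: Ints_cases)
    next
      case False
      hence "of_int \<lfloor>dot d h x\<rfloor> \<noteq> dot d h x" by (metis Ints_of_int)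
      hence "of_int \<lfloor>dot d h x\<rfloor> < dot d h x" using of_int_floor_le[of "dot d h x"] by linarith
      hence "x \<in> slab d h \<lfloor>dot d h x\<rfloor>"
        using x B(2) by (auto simp: slab_def)
      with cover[OF x] False show ?thesis by blast
    qed
  qed
  hence "emeasure (leb d) B \<le> emeasure (leb d) ((\<Union>k\<in>K. slab d h k) \<union> ?N)"
    using U N by (intro emeasure_mono) auto
  also have "\<dots> = emeasure (leb d) (\<Union>k\<in>K. slab d h k)"
    by (rule emeasure_Un_null_set[OF U N])
  also have "\<dots> \<le> (\<Sum>k\<in>K. emeasure (leb d) (slab d h k))"
    using K sets_slab by (intro emeasure_subadditive_finite) auto
  also have "\<dots> \<le> (\<Sum>k\<in>K. ennreal ?J)"
    using measure_slab_le_isotropic_discrepancy[OF L h(1)] fin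
    by (intro sum_mono) (auto simp: emeasure_eq_ennreal_measure intro!: ennreal_leI)
  also have "\<dots> = ennreal (real (card K) * ?J)"
    by (simp add: ennreal_mult'' ennreal_of_nat_eq_real_of_nat ennreal_mult')
  finally have "emeasure (leb d) B \<le> ennreal (real (card K) * ?J)" .
  moreover have "0 \<le> ?J" by (rule isotropic_discrepancy_nonneg[OF L h(1)])
  ultimately show ?thesis
    by (simp add: measure_def enn2real_leI)
qed

lemma isotropic_discrepancy_lower:
  assumes d: "d \<ge> 1" and L: "integration_lattice d L"
  shows "1 / sqrt (real d) * spectral_test d L
    \<le> isotropic_discrepancy d (card (lattice_points d L)) (lattice_points d L)"
proof -
  let ?J = "isotropic_discrepancy d (card (lattice_points d L)) (lattice_points d L)"
  obtain h where h: "h \<in> dual_lattice d L" "dot d h h \<ge> 1"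
    "spectral_test d L = 1 / sqrt (dot d h h)"
    using spectral_test_attained[OF d L] by metis
  define m where "m i = \<lfloor>h i\<rfloor>" for i
  have m: "h i = of_int (m i)" if "i < d" for i
    using dual_lattice_coord_Ints[OF L h(1) that] by (auto simp: m_def elim: Ints_cases)
  \<comment> \<open>The sums of the negative and of the positive parts of the coordinates bound
    \<open>dot d h x\<close> on the cube. Their difference is the l1 norm of \<open>h\<close>, which
    is the number of slabs.\<close>
  define a where "a = - (\<Sum>i<d. max 0 (- m i))"
  define b where "b = (\<Sum>i<d. max 0 (m i))"
  have ab: "b - a = (\<Sum>i<d. \<bar>m i\<bar>)"
    unfolding a_def b_def by (simp flip: sum.distrib) (intro sum.cong, auto)
  have bounds: "of_int a \<le> dot d h x \<and> dot d h x \<le> of_int b" if "x \<in> unit_cube d" for x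
  proof -
    have x: "0 \<le> x i" "x i \<le> 1" if "i < d" for i
      using PiE_mem[of x "{..<d}" "\<lambda>_. {0..<1}" i] \<open>x \<in> unit_cube d\<close> that by (auto simp: unit_cube_def)
    have "- of_int (max 0 (- m i)) \<le> h i * x i \<and> h i * x i \<le> of_int (max 0 (m i))" if "i < d" for i
    proof (cases "0 \<le> m i")
      case True
      then show ?thesis using x[OF that] m[OF that] by (simp add: mult_left_le)
    next
      case False
      hence "of_int (m i) * 1 \<le> of_int (m i) * x i" "of_int (m i) * x i \<le> 0"
        using x[OF that] by (intro mult_left_mono_neg, auto simp: mult_nonpos_nonneg)
      then show ?thesis using False m[OF that] by simp
    qed
    then show ?thesis
      unfolding dot_def a_def b_def of_int_minus of_int_sum sum_negf[symmetric]
      by (intro conjI sum_mono) auto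
  qed
  have "measure (leb d) (unit_cube d) \<le> real (card {a..<b}) * ?J"
  proof (rule measure_le_slab_count[OF L h(1) _ sets_unit_cube order_refl])
    fix x assume "x \<in> unit_cube d"
    with bounds have *: "of_int a \<le> dot d h x" "dot d h x \<le> of_int b" by auto
    \<comment> \<open>The slab starting at \<open>b\<close> is spared: the only value whose floor is
      \<open>b\<close> is \<open>b\<close> itself, which is integral.\<close>
    show "\<lfloor>dot d h x\<rfloor> \<in> {a..<b} \<or> dot d h x \<in> \<int>"
    proof (cases "dot d h x = of_int b")
      case False
      with * show ?thesis by (auto simp: le_floor_iff floor_less_iff)
    qed simp
  qed (use h in auto)
  moreover have "measure (leb d) (unit_cube d) = 1"
    by (simp add: measure_def emeasure_unit_cube)
  moreover have "real (card {a..<b}) = (\<Sum>i<d. \<bar>h i\<bar>)"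
  proof -
    have "0 \<le> b - a" unfolding ab by (simp add: sum_nonneg)
    hence "real (card {a..<b}) = of_int (b - a)" by simp
    also have "\<dots> = (\<Sum>i<d. \<bar>h i\<bar>)" unfolding ab using m by simp
    finally show ?thesis .
  qed
  ultimately have one: "1 \<le> (\<Sum>i<d. \<bar>h i\<bar>) * ?J" by (simp only:)
  \<comment> \<open>Cauchy-Schwarz compares the l1 norm with the Euclidean one and brings in the
    factor \<open>sqrt (real d)\<close>.\<close>
  have "(\<Sum>i<d. \<bar>h i\<bar>)\<^sup>2 \<le> dot d h h * real d"
    using sum_squared_le_sum_of_squares[of "\<lambda>i. \<bar>h i\<bar>" "{..<d}"]
    by (simp add: dot_def power2_eq_square)
  hence le: "(\<Sum>i<d. \<bar>h i\<bar>) \<le> sqrt (real d) * sqrt (dot d h h)"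
    using real_le_rsqrt by (simp add: mult.commute flip: real_sqrt_mult)
  have J: "0 \<le> ?J" by (rule isotropic_discrepancy_nonneg[OF L h(1)])
  have "1 \<le> (sqrt (real d) * sqrt (dot d h h)) * ?J"
    using one mult_right_mono[OF le J] by linarith
  then show ?thesis
    using d h(2) by (simp add: h(3) field_simps)
qed

section \<open>Second moment of a linear form on the unit cube\<close>

lemma has_bochner_integral_unit_interval:
  fixes p F :: "real \<Rightarrow> real"
  assumes "\<And>x. (F has_real_derivative p x) (at x)" "\<And>x. isCont p x"
  shows "has_bochner_integral lborel (\<lambda>x. indicator {0..<1} x * p x) (F 1 - F 0)"
proof -
  have "has_bochner_integral lborel (\<lambda>x. p x * indicator {0..1} x) (F 1 - F 0)"
    by (rule has_bochner_integral_FTC_Icc_real) (use assms in auto)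
  moreover have "has_bochner_integral lborel (\<lambda>x. indicator {0..<1} x * p x) (F 1 - F 0) \<longleftrightarrow>
      has_bochner_integral lborel (\<lambda>x. p x * indicator {0..1} x) (F 1 - F 0)"
  proof (rule has_bochner_integral_cong_AE)
    have [measurable]: "p \<in> borel_measurable borel"
      using assms(2) by (intro borel_measurable_continuous_onI continuous_at_imp_continuous_on) auto
    show "(\<lambda>x. indicator {0..<1} x * p x) \<in> borel_measurable lborel"
      "(\<lambda>x. p x * indicator {0..1} x) \<in> borel_measurable lborel" by measurable
    show "AE x in lborel. indicator {0..<1} x * p x = p x * indicator {0..1} x"
      by (rule eventually_mono[OF AE_lborel_singleton[of 1]]) (auto simp: indicator_def)
  qed
  ultimately show ?thesis by simp
qed

text \<open>The coordinates are independent and uniform: after centring, mixed terms integrate to 0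
  and each square to 1 / 12.\<close>

lemma second_moment:
  fixes h :: "nat \<Rightarrow> real" and d :: nat
  defines "g \<equiv> \<lambda>x. \<Sum>i<d. h i * (x i - 1 / 2)"
  shows "integrable (leb d) (\<lambda>x. indicator (unit_cube d) x * (g x)\<^sup>2)"
    and "(\<integral>x. indicator (unit_cube d) x * (g x)\<^sup>2 \<partial>leb d) = dot d h h / 12"
proof -
  \<comment> \<open>\<open>q i j k\<close> is the factor that coordinate \<open>k\<close>
    contributes to the product of the centred coordinates \<open>i\<close> and \<open>j\<close>,
    squared if \<open>i = j = k\<close>. Each term thus becomes a product of one-variable
    functions.\<close>
  define q where "q i j k t = (if k = i then t - 1 / 2 else 1) * (if k = j then t - 1 / 2 else 1)"
    for i j k :: nat and t :: real
  define f where "f i j k t = indicator {0..<1} t * q i j k t" for i j k t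
  have b0: "has_bochner_integral lborel (\<lambda>t::real. indicator {0..<1} t * 1) (1 - 0 :: real)"
    using has_bochner_integral_unit_interval[of "\<lambda>t. t" "\<lambda>_. 1"] by simp
  have b1: "has_bochner_integral lborel (\<lambda>t::real. indicator {0..<1} t * (t - 1 / 2)) (0 :: real)"
  proof -
    have "((\<lambda>t. t\<^sup>2 / 2 - t / 2) has_real_derivative t - 1 / 2) (at t)" for t :: real
      by (auto intro!: derivative_eq_intros)
    from has_bochner_integral_unit_interval[OF this] show ?thesis by simp
  qed
  have b2: "has_bochner_integral lborel (\<lambda>t::real. indicator {0..<1} t * (t - 1 / 2)\<^sup>2) (1 / 12 :: real)"
  proof -
    have "((\<lambda>t. t ^ 3 / 3 - t\<^sup>2 / 2 + t / 4) has_real_derivative (t - 1 / 2)\<^sup>2) (at t)" for t :: real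
      by (auto intro!: derivative_eq_intros simp: power2_eq_square field_simps)
    from has_bochner_integral_unit_interval[OF this] show ?thesis by simp
  qed
  have f: "has_bochner_integral lborel (f i j k)
      (if k = i \<and> k = j then 1 / 12 else if k = i \<or> k = j then 0 else 1)" for i j k
    using b0 b1 b2 unfolding f_def q_def by (auto simp: power2_eq_square)
  have fint: "integrable lborel (f i j k)" for i j k
    using f has_bochner_integral_iff by blast
  have prod_int: "integrable (leb d) (\<lambda>x. \<Prod>k<d. f i j k (x k))" for i j
    by (rule lborel_prod.product_integrable_prod) (use fint in auto)
  have prod_val: "(\<integral>x. (\<Prod>k<d. f i j k (x k)) \<partial>leb d) = (if i = j then 1 / 12 else 0)"
    if "i < d" "j < d" for i j
  proof -
    have "(\<integral>x. (\<Prod>k<d. f i j k (x k)) \<partial>leb d) = (\<Prod>k<d. integral\<^sup>L lborel (f i j k))"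
      by (rule lborel_prod.product_integral_prod) (use fint in auto)
    also have "\<dots> = (\<Prod>k<d. if k = i \<and> k = j then 1 / 12 else if k = i \<or> k = j then 0 else 1)"
      using f has_bochner_integral_iff by (intro prod.cong refl) blast
    also have "\<dots> = (if i = j then 1 / 12 else 0)"
    proof (cases "i = j")
      case True
      hence "(\<Prod>k<d. if k = i \<and> k = j then 1 / 12 else if k = i \<or> k = j then 0 else 1)
          = (\<Prod>k<d. if k = j then 1 / 12 else 1 :: real)"
        by (intro prod.cong) auto
      with True that show ?thesis by (simp add: prod.delta)
    next
      case False
      then show ?thesis using that by (auto intro!: bexI[of _ i])
    qed
    finally show ?thesis .
  qed
  have expand: "indicator (unit_cube d) x * (g x)\<^sup>2 = (\<Sum>i<d. \<Sum>j<d. h i * h j * (\<Prod>k<d. f i j k (x k)))"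
    if x: "x \<in> space (leb d)" for x
  proof -
    have ind: "(\<Prod>k<d. indicator {0..<1} (x k)) = (indicator (unit_cube d) x :: real)"
    proof (cases "x \<in> unit_cube d")
      case True
      hence "x k \<in> {0..<1}" if "k < d" for k using that unfolding unit_cube_def by (blast dest: PiE_mem)
      with True show ?thesis by (simp add: indicator_def)
    next
      case False
      then obtain k where "k < d" "x k \<notin> {0..<1}"
        using x unfolding space_leb eucl_space_def unit_cube_def PiE_iff by auto
      with False show ?thesis by (auto intro!: bexI[of _ k])
    qed
    have q: "(\<Prod>k<d. q i j k (x k)) = (x i - 1 / 2) * (x j - 1 / 2)" if "i < d" "j < d" for i j
      unfolding q_def prod.distrib using that by (simp add: prod.delta)
    have "(\<Sum>i<d. \<Sum>j<d. h i * h j * (\<Prod>k<d. f i j k (x k)))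
        = (\<Sum>i<d. \<Sum>j<d. h i * h j * (indicator (unit_cube d) x * ((x i - 1 / 2) * (x j - 1 / 2))))"
      by (intro sum.cong refl) (simp add: f_def prod.distrib ind q)
    also have "\<dots> = indicator (unit_cube d) x * (\<Sum>i<d. \<Sum>j<d. (h i * (x i - 1 / 2)) * (h j * (x j - 1 / 2)))"
      by (simp add: sum_distrib_left mult_ac)
    also have "(\<Sum>i<d. \<Sum>j<d. (h i * (x i - 1 / 2)) * (h j * (x j - 1 / 2))) = (g x)\<^sup>2"
      by (simp add: g_def power2_eq_square sum_product)
    finally show ?thesis ..
  qed
  have "integrable (leb d) (\<lambda>x. \<Sum>i<d. \<Sum>j<d. h i * h j * (\<Prod>k<d. f i j k (x k)))"
    by (intro Bochner_Integration.integrable_sum integrable_mult_right prod_int)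
  then show "integrable (leb d) (\<lambda>x. indicator (unit_cube d) x * (g x)\<^sup>2)"
    by (subst Bochner_Integration.integrable_cong[OF refl expand])
  have "(\<integral>x. indicator (unit_cube d) x * (g x)\<^sup>2 \<partial>leb d)
      = (\<integral>x. (\<Sum>i<d. \<Sum>j<d. h i * h j * (\<Prod>k<d. f i j k (x k))) \<partial>leb d)"
    by (intro Bochner_Integration.integral_cong refl expand)
  also have "\<dots> = (\<Sum>i<d. \<Sum>j<d. h i * h j * (\<integral>x. (\<Prod>k<d. f i j k (x k)) \<partial>leb d))"
    by (simp add: Bochner_Integration.integral_sum prod_int)
  also have "\<dots> = (\<Sum>i<d. \<Sum>j<d. if i = j then h i * h i / 12 else 0)"
    by (intro sum.cong refl) (auto simp: prod_val)
  also have "\<dots> = dot d h h / 12"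
    by (simp add: dot_def sum_divide_distrib)
  finally show "(\<integral>x. indicator (unit_cube d) x * (g x)\<^sup>2 \<partial>leb d) = dot d h h / 12" .
qed

text \<open>With \<open>s\<close> the length of \<open>h\<close>, the variance is
  \<open>s\<^sup>2 / 12\<close>, so Chebyshev at radius \<open>s\<close> leaves volume at least 11 /
  12, hence 3 / 4. An interval of length 2 s meets at most 2 s + 2 unit slabs, which is at most 4 s
  since \<open>s\<close> is at least 1. The quotient of 3 / 4 and 4 s is the constant 3 / 16 times
  the spectral test.\<close>

lemma isotropic_discrepancy_lower_absolute:
  assumes d: "d \<ge> 1" and L: "integration_lattice d L"
  shows "3 / 16 * spectral_test d L
    \<le> isotropic_discrepancy d (card (lattice_points d L)) (lattice_points d L)"
proof -
  let ?J = "isotropic_discrepancy d (card (lattice_points d L)) (lattice_points d L)"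
  obtain h where h: "h \<in> dual_lattice d L" "dot d h h \<ge> 1"
    "spectral_test d L = 1 / sqrt (dot d h h)"
    using spectral_test_attained[OF d L] by metis
  define s where "s = sqrt (dot d h h)"
  have s: "1 \<le> s" "s\<^sup>2 = dot d h h" using h(2) by (auto simp: s_def)
  define \<mu> where "\<mu> = (\<Sum>i<d. h i / 2)"
  define g where "g x = (\<Sum>i<d. h i * (x i - 1 / 2))" for x
  have g: "g x = dot d h x - \<mu>" for x
    by (simp add: g_def \<mu>_def dot_def algebra_simps sum_subtractf)
  define B where "B = {x \<in> unit_cube d. \<bar>g x\<bar> < s}"
  define B' where "B' = {x \<in> unit_cube d. s \<le> \<bar>g x\<bar>}"
  have gm: "g \<in> borel_measurable (leb d)"
    unfolding g using measurable_dot[of d h] by measurable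
  have Beq: "B = unit_cube d \<inter> {x \<in> space (leb d). \<bar>g x\<bar> < s}"
    and B'eq: "B' = unit_cube d \<inter> {x \<in> space (leb d). s \<le> \<bar>g x\<bar>}"
    using unit_cube_subset by (auto simp: B_def B'_def space_leb)
  have B: "B \<in> sets (leb d)" and B': "B' \<in> sets (leb d)"
    unfolding Beq B'eq using gm by measurable
  have fm: "unit_cube d \<in> fmeasurable (leb d)"
    by (rule fmeasurableI) (simp_all add: emeasure_unit_cube)
  hence Bf: "B \<in> fmeasurable (leb d)" "B' \<in> fmeasurable (leb d)"
    using B B' by (auto intro!: fmeasurableI2[OF fm] simp: B_def B'_def)
  have "measure (leb d) B' \<le> 1 / 12"
  proof -
    have "s\<^sup>2 * measure (leb d) B' = (\<integral>x. s\<^sup>2 * indicator B' x \<partial>leb d)"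
      using B' Bf sets.sets_into_space[OF B'] by (simp add: Int_absorb2)
    also have "\<dots> \<le> (\<integral>x. indicator (unit_cube d) x * (g x)\<^sup>2 \<partial>leb d)"
    proof (rule integral_mono)
      show "integrable (leb d) (\<lambda>x. s\<^sup>2 * indicator B' x)"
        using Bf by (auto simp: fmeasurable_def)
      show "integrable (leb d) (\<lambda>x. indicator (unit_cube d) x * (g x)\<^sup>2)"
        unfolding g_def by (rule second_moment)
      show "s\<^sup>2 * indicator B' x \<le> indicator (unit_cube d) x * (g x)\<^sup>2" for x
      proof (cases "x \<in> B'")
        case True
        hence "\<bar>s\<bar> \<le> \<bar>g x\<bar>" using s(1) by (simp add: B'_def)
        hence "s\<^sup>2 \<le> (g x)\<^sup>2" by (rule abs_le_square_iff[THEN iffD1])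
        with True show ?thesis by (auto simp: B'_def)
      qed simp
    qed
    also have "\<dots> = s\<^sup>2 / 12" unfolding g_def second_moment s(2) ..
    finally show ?thesis using s(1) by (simp add: field_simps)
  qed
  moreover have "measure (leb d) (unit_cube d) \<le> measure (leb d) B + measure (leb d) B'"
  proof -
    have "unit_cube d = B \<union> B'" by (auto simp: B_def B'_def)
    then show ?thesis using measure_Un_le[OF B B'] by simp
  qed
  moreover have "measure (leb d) (unit_cube d) = 1"
    by (simp add: measure_def emeasure_unit_cube)
  ultimately have "3 / 4 \<le> measure (leb d) B" by linarith
  also have "\<dots> \<le> real (card {\<lfloor>\<mu> - s\<rfloor>..\<lfloor>\<mu> + s\<rfloor>}) * ?J"
  proof (rule measure_le_slab_count[OF L h(1) _ B])
    fix x assume "x \<in> B"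
    hence "\<mu> - s < dot d h x" "dot d h x < \<mu> + s" by (auto simp: B_def g abs_less_iff)
    then show "\<lfloor>dot d h x\<rfloor> \<in> {\<lfloor>\<mu> - s\<rfloor>..\<lfloor>\<mu> + s\<rfloor>} \<or> dot d h x \<in> \<int>"
      by (auto intro!: floor_mono)
  qed (use h in \<open>auto simp: B_def\<close>)
  also have "\<dots> \<le> (4 * s) * ?J"
  proof (rule mult_right_mono)
    have "real (card {\<lfloor>\<mu> - s\<rfloor>..\<lfloor>\<mu> + s\<rfloor>}) = of_int (\<lfloor>\<mu> + s\<rfloor> - \<lfloor>\<mu> - s\<rfloor> + 1)"
      using s floor_mono[of "\<mu> - s" "\<mu> + s"] by simp
    also have "\<dots> \<le> (\<mu> + s) - (\<mu> - s - 1) + 1"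
      by simp linarith
    also have "\<dots> \<le> 4 * s" using s by simp
    finally show "real (card {\<lfloor>\<mu> - s\<rfloor>..\<lfloor>\<mu> + s\<rfloor>}) \<le> 4 * s" .
    show "0 \<le> ?J" by (rule isotropic_discrepancy_nonneg[OF L h(1)])
  qed
  finally show ?thesis
    using s(1) by (simp add: h(3) s_def[symmetric] field_simps)
qed

theorem theorem2:
  shows "(\<forall>(d::nat) (N::nat) (L :: (nat \<Rightarrow> real) set).
            d \<ge> 1 \<and> integration_lattice d L \<and> card (lattice_points d L) = N \<longrightarrow>
              1 / sqrt (real d) * spectral_test d L
                \<le> isotropic_discrepancy d N (lattice_points d L) \<and>
              isotropic_discrepancy d N (lattice_points d L)
                \<le> real d ^ 2 * 2 ^ d * spectral_test d L) \<and>
         (\<exists>c::real. c > 0 \<and>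
           (\<forall>(d::nat) (N::nat) (L :: (nat \<Rightarrow> real) set).
              d \<ge> 1 \<and> integration_lattice d L \<and> card (lattice_points d L) = N \<and>
              spectral_test d L \<le> 1 / 2 \<longrightarrow>
                c * spectral_test d L \<le> isotropic_discrepancy d N (lattice_points d L)))"
  using isotropic_discrepancy_lower isotropic_discrepancy_upper isotropic_discrepancy_lower_absolute
  by (intro conjI exI[of _ "3 / 16"]) auto

end
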